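(* Let $n\ge4$ be an integer and let $t_1=\dfrac{-(n-2)(2n-3)-\sqrt{3(n-2)(2n-3)}}{2(2n-1)(2n-3)}$. Then the function $a\mapsto A^2_{n,3}(a)$ on $[0;1]$ attains its maximum at $a_1^{\pm}=\frac12\pm\frac12\sqrt{1+4t_1}$, and this maximum equals $$ \Lambda_{n,3}^2=\left(\frac{(n-2)(2n-3)+\sqrt{3(n-2)(2n-3)}}{(2n-1)(2n-3)}\right)^{2n-7}\cdot\frac{3(n-2)\left(3(n-2)(2n-5)-\sqrt3\,(2n-7)\sqrt{(n-2)(2n-3)}\right)}{4^{\,n-3}((n-2)!)^2(2n-1)^2(2n-7)}. $$
   Context: For integers $n\ge1$, $0\le k\le n-1$ and $a\in[0;1]$, $A_{n,k}(a):=\sup\{|f^{(k)}(a)| : f\in \mathring{W}_2^n[0;1],\ \int_0^1|f^{(n)}(x)|^2dx\le 1\}$, $A^2_{n,k}(a)=(A_{n,k}(a))^2$, and the sharp embedding constant is $\Lambda_{n,k}:=\sup_{a\in[0;1]}A_{n,k}(a)$. Here $\mathring{W}_2^n[0;1]$ is the space of functions $f$ on $[0;1]$ whose derivatives up to order $n-1$ are absolutely continuous, with $f^{(n)}\in L_2[0;1]$ and $f^{(j)}(0)=f^{(j)}(1)=0$ for $j=0,\dots,n-1$. *)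

theory Defs
  imports "HOL-Analysis.Analysis"
begin

definition abs_continuous_on_interval :: "real \<Rightarrow> real \<Rightarrow> (real \<Rightarrow> real) \<Rightarrow> bool" where
  "abs_continuous_on_interval a b f \<longleftrightarrow>
     (\<forall>\<epsilon>>0. \<exists>\<delta>>0. \<forall>(N::nat) u v.
        (\<forall>i<N. a \<le> u i \<and> u i \<le> v i \<and> v i \<le> b) \<and>
        disjoint_family_on (\<lambda>i. {u i<..<v i}) {..<N} \<and>
        (\<Sum>i<N. v i - u i) < \<delta> \<longrightarrow>
        (\<Sum>i<N. \<bar>f (v i) - f (u i)\<bar>) < \<epsilon>)"

text \<open>
  Derivatives are taken within \<open>{0..1}\<close>, so they are one-sided at the endpoints and, at points of
  \<open>{0..1}\<close>, do not depend on the values of \<open>f\<close> outside it. Where the derivative does not exist,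
  the value of \<^const>\<open>vector_derivative\<close> is unspecified.
\<close>
primrec deriv01 :: "nat \<Rightarrow> (real \<Rightarrow> real) \<Rightarrow> real \<Rightarrow> real" where
  "deriv01 0 f = f"
| "deriv01 (Suc k) f = (\<lambda>x. vector_derivative (deriv01 k f) (at x within {0..1}))"

text \<open>
  The space is meant for \<open>n \<ge> 1\<close>. The derivatives of order \<open>< n\<close> must exist everywhere on
  \<open>{0..1}\<close>, the one of order \<open>n\<close> only almost everywhere. The latter follows from absolute
  continuity, by Lebesgue's differentiation theorem; it is spelled out because \<^const>\<open>deriv01\<close> is
  meaningful only where the derivative exists.
\<close>
definition W2_ring :: "nat \<Rightarrow> (real \<Rightarrow> real) set" where
  "W2_ring n = {f.
     (\<forall>j. Suc j < n \<longrightarrow> deriv01 j f differentiable_on {0..1}) \<and>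
     (\<forall>j<n. abs_continuous_on_interval 0 1 (deriv01 j f)) \<and>
     (AE x in lebesgue_on {0..1}. deriv01 (n - 1) f differentiable (at x within {0..1})) \<and>
     deriv01 n f \<in> borel_measurable (lebesgue_on {0..1}) \<and>
     integrable (lebesgue_on {0..1}) (\<lambda>x. \<bar>deriv01 n f x\<bar>\<^sup>2) \<and>
     (\<forall>j<n. deriv01 j f 0 = 0 \<and> deriv01 j f 1 = 0)}"

text \<open>
  For \<open>0 \<le> k < n\<close> and \<open>a \<in> {0..1}\<close> the suprema below are over nonempty bounded sets of reals;
  only these parameters are meaningful.
\<close>
definition A_emb :: "nat \<Rightarrow> nat \<Rightarrow> real \<Rightarrow> real" where
  "A_emb n k a =
     (SUP f\<in>{f \<in> W2_ring n. (LINT x|lebesgue_on {0..1}. \<bar>deriv01 n f x\<bar>\<^sup>2) \<le> 1}.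
        \<bar>deriv01 k f a\<bar>)"

definition Lambda_emb :: "nat \<Rightarrow> nat \<Rightarrow> real" where
  "Lambda_emb n k = (SUP a\<in>{0..1}. A_emb n k a)"

end

theory Submission
  imports Defs "HOL-Computational_Algebra.Polynomial"
begin

text \<open>
  Integrating by parts, \<open>f\<^sup>(\<^sup>k\<^sup>)(a)\<close> is the \<open>L\<^sub>2\<close> scalar product of \<open>f\<^sup>(\<^sup>n\<^sup>)\<close> with
  \<open>g(x) = (a - x)\<^sub>+\<^sup>r / r!\<close>, \<open>r = n - k - 1\<close>, while the derivatives \<open>f\<^sup>(\<^sup>n\<^sup>)\<close> are exactly the functions
  orthogonal to all polynomials of degree \<open>< n\<close>. So the square of \<open>A_emb n k a\<close> is the squared distance from
  \<open>g\<close> to these polynomials. As \<open>g\<close> depends on \<open>n - k\<close> only, raising \<open>n\<close> and \<open>k\<close> together by one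
  subtracts the contribution of one Legendre polynomial. The case \<open>k = 0\<close> is explicit: expanding
  \<open>(a - x)\<^sup>2\<^sup>n\<^sup>-\<^sup>1 = (a(1 - x) - (1 - a)x)\<^sup>2\<^sup>n\<^sup>-\<^sup>1\<close> binomially splits it into a multiple of \<open>x\<^sup>n\<close> and a
  multiple of \<open>(1 - x)\<^sup>n\<close>, the two pieces of the extremal spline. Three steps from \<open>k = 0\<close> give
  the square of \<open>A_emb n 3 a\<close> as a polynomial in \<open>s = a(1 - a)\<close> whose derivative has three roots
  \<open>s0 < z < s1 < 1/4\<close> besides \<open>0\<close>; the values at the two local maxima \<open>s0\<close> and \<open>s1\<close>
  are compared through \<open>x \<le> artanh x \<le> x / (1 - x\<^sup>2)\<close>.
\<close>

subsection \<open>Absolutely continuous functions\<close>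

text \<open>Recasts the indexed families of the definition as tagged partial divisions, the form
  that the gauge integral supplies. Enumerating the division gives the indices, and disjoint
  interiors become disjoint open intervals.\<close>

lemma abs_continuous_on_intervalD:
  assumes "abs_continuous_on_interval a b f" "\<epsilon> > 0"
  obtains \<delta> where "\<delta> > 0"
    "\<And>p. p tagged_partial_division_of {a..b} \<Longrightarrow> (\<Sum>(x,K)\<in>p. Sup K - Inf K) < \<delta> \<Longrightarrow>
      (\<Sum>(x,K)\<in>p. \<bar>f (Sup K) - f (Inf K)\<bar>) < \<epsilon>"
proof -
  obtain \<delta> where "\<delta> > 0" and \<delta>: "\<forall>(N::nat) u v. (\<forall>i<N. a \<le> u i \<and> u i \<le> v i \<and> v i \<le> b) \<and>
        disjoint_family_on (\<lambda>i. {u i<..<v i}) {..<N} \<and> (\<Sum>i<N. v i - u i) < \<delta> \<longrightarrow>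
        (\<Sum>i<N. \<bar>f (v i) - f (u i)\<bar>) < \<epsilon>"
    using assms unfolding abs_continuous_on_interval_def by blast
  show ?thesis
  proof (rule that [OF \<open>\<delta> > 0\<close>])
    fix p assume p: "p tagged_partial_division_of {a..b}" and small: "(\<Sum>(x,K)\<in>p. Sup K - Inf K) < \<delta>"
    note pD = tagged_partial_division_ofD [OF p]
    obtain h where h: "bij_betw h {..<card p} p"
      using pD(1) by (metis ex_bij_betw_nat_finite atLeast0LessThan)
    define u where "u i = Inf (snd (h i))" for i
    define v where "v i = Sup (snd (h i))" for i
    have K: "a \<le> u i \<and> u i \<le> v i \<and> v i \<le> b \<and> interior (snd (h i)) = {u i<..<v i}" if "i < card p" for i
    proof -
      have hp: "(fst (h i), snd (h i)) \<in> p"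
        using h that by (auto simp: bij_betw_def)
      obtain c d where cd: "snd (h i) = {c..d}"
        using pD(4) [OF hp] by auto
      have "fst (h i) \<in> {c..d}" "{c..d} \<subseteq> {a..b}"
        using pD(2,3) [OF hp] cd by auto
      then have "c \<le> d" "a \<le> c" "d \<le> b"
        by auto
      then show ?thesis
        by (simp add: u_def v_def cd)
    qed
    have "disjoint_family_on (\<lambda>i. {u i<..<v i}) {..<card p}"
      unfolding disjoint_family_on_def
    proof (intro ballI impI)
      fix i j assume ij: "i \<in> {..<card p}" "j \<in> {..<card p}" "i \<noteq> j"
      then have "h i \<noteq> h j" "h i \<in> p" "h j \<in> p"
        using h by (auto simp: bij_betw_def inj_on_def)
      then have "interior (snd (h i)) \<inter> interior (snd (h j)) = {}"
        using pD(5) [of "fst (h i)" "snd (h i)" "fst (h j)" "snd (h j)"] by simp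
      then show "{u i<..<v i} \<inter> {u j<..<v j} = {}"
        using K ij by auto
    qed
    moreover have "(\<Sum>i<card p. v i - u i) = (\<Sum>(x,K)\<in>p. Sup K - Inf K)"
      using sum.reindex_bij_betw [OF h, of "\<lambda>(x,K). Sup K - Inf K"] by (simp add: u_def v_def case_prod_unfold)
    moreover have "(\<Sum>i<card p. \<bar>f (v i) - f (u i)\<bar>) = (\<Sum>(x,K)\<in>p. \<bar>f (Sup K) - f (Inf K)\<bar>)"
      using sum.reindex_bij_betw [OF h, of "\<lambda>(x,K). \<bar>f (Sup K) - f (Inf K)\<bar>"]
      by (simp add: u_def v_def case_prod_unfold)
    ultimately show "(\<Sum>(x,K)\<in>p. \<bar>f (Sup K) - f (Inf K)\<bar>) < \<epsilon>"
      using \<delta> [rule_format, of "card p" u v] K small by simp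
  qed
qed

text \<open>Nonoverlapping intervals have total length equal to the measure of their union. Two tags
  can share an interval only if its interior is empty, so passing to the set of intervals loses no
  length.\<close>

lemma sum_tagged_partial_division_le_measure:
  fixes p :: "(real \<times> real set) set"
  assumes p: "p tagged_partial_division_of S" and U: "U \<in> lmeasurable" "\<And>x K. (x,K) \<in> p \<Longrightarrow> K \<subseteq> U"
  shows "(\<Sum>(x,K)\<in>p. Sup K - Inf K) \<le> measure lebesgue U"
proof -
  note pD = tagged_partial_division_ofD [OF p]
  have tag: "p tagged_division_of (\<Union>(snd ` p))"
    using tagged_partial_division_of_Union_self [OF p] .
  have div: "snd ` p division_of (\<Union>(snd ` p))"
    using division_of_tagged_division [OF tag] .
  have K: "Sup K - Inf K = measure lborel K" if "(x,K) \<in> p" for x K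
    using pD(2,4) [OF that] by (auto simp: content_real)
  then have "(\<Sum>(x,K)\<in>p. Sup K - Inf K) = (\<Sum>(x,K)\<in>p. measure lborel K)"
    by (intro sum.cong) auto
  also have "\<dots> = sum (measure lborel) (snd ` p)"
    using sum.over_tagged_division_lemma [OF tag, of "measure lborel"] by (simp add: content_eq_0_interior)
  also have "\<dots> = (\<Sum>K\<in>snd ` p. measure lebesgue K)"
  proof (rule sum.cong)
    fix K assume "K \<in> snd ` p"
    then obtain u v where "K = {u..v}"
      using pD(4) by fastforce
    then show "measure lborel K = measure lebesgue K"
      by simp
  qed simp
  also have "\<dots> = measure lebesgue (\<Union>(snd ` p))"
    using content_division [OF div] .
  also have "\<dots> \<le> measure lebesgue U"
  proof (rule measure_mono_fmeasurable)
    show "\<Union>(snd ` p) \<subseteq> U"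
      using U(2) by (intro Union_least) (metis imageE prod.collapse)
  qed (use U(1) in \<open>auto intro: lmeasurable_division [OF div] fmeasurableD\<close>)
  finally show ?thesis .
qed

text \<open>The gauge integral reduces the claim to Riemann sums: off \<open>N\<close> the
  derivative approximates each increment of \<open>f\<close>, and the increments over intervals
  tagged in \<open>N\<close> are small in total by absolute continuity.\<close>

lemma fundamental_theorem_of_calculus_abs_continuous:
  fixes f :: "real \<Rightarrow> real"
  assumes "a \<le> b" and ac: "abs_continuous_on_interval a b f" and N: "negligible N"
    and der: "\<And>x. x \<in> {a..b} - N \<Longrightarrow> (f has_vector_derivative f' x) (at x within {a..b})"
  shows "(f' has_integral (f b - f a)) {a..b}"
proof -
  \<comment> \<open>With the integrand set to 0 on \<open>N\<close>, a tag in \<open>N\<close>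
    contributes only an increment of \<open>f\<close>. The spike at the end restores
    \<open>f'\<close>.\<close>
  define g where "g x = (if x \<in> N then 0 else f' x)" for x
  have "(g has_integral (f b - f a)) {a..b}"
    unfolding has_integral_real
  proof (intro allI impI)
    fix e :: real assume "e > 0"
    \<comment> \<open>The \<open>+ 1\<close> keeps the denominator positive when
      \<open>a = b\<close>.\<close>
    define e' where "e' = e / (2 * (b - a + 1))"
    have "e' > 0"
      using \<open>e > 0\<close> \<open>a \<le> b\<close> by (simp add: e'_def)
    obtain \<delta> where "\<delta> > 0" and \<delta>: "\<And>p. p tagged_partial_division_of {a..b} \<Longrightarrow>
        (\<Sum>(x,K)\<in>p. Sup K - Inf K) < \<delta> \<Longrightarrow> (\<Sum>(x,K)\<in>p. \<bar>f (Sup K) - f (Inf K)\<bar>) < e/2"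
      using abs_continuous_on_intervalD [OF ac, of "e/2"] \<open>e > 0\<close> by auto
    \<comment> \<open>Outer regularity: a null set lies in open sets of arbitrarily small
      measure.\<close>
    obtain U where U: "open U" "N \<subseteq> U" "U \<in> lmeasurable" "measure lebesgue U < \<delta>"
    proof -
      have "N \<in> null_sets lebesgue"
        using N by (simp add: negligible_iff_null_sets)
      then obtain T where T: "open T" "N \<subseteq> T" "T - N \<in> lmeasurable" "emeasure lebesgue (T - N) < ennreal \<delta>"
        using sets_lebesgue_outer_open \<open>\<delta> > 0\<close> by blast
      have "T = (T - N) \<union> N" using T by auto
      then have "T \<in> lmeasurable"
        by (metis T(3) N fmeasurable.Un negligible_imp_measurable)
      moreover have "emeasure lebesgue T = emeasure lebesgue (T - N)"
        using \<open>N \<in> null_sets lebesgue\<close> T by (simp add: emeasure_Diff_null_set)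
      ultimately show ?thesis
        using that T \<open>\<delta> > 0\<close> by (metis emeasure_eq_measure2 ennreal_less_iff measure_nonneg)
    qed
    have "\<forall>x. \<exists>d>0. (x \<in> N \<longrightarrow> ball x d \<subseteq> U) \<and> (x \<in> {a..b} - N \<longrightarrow>
           (\<forall>y\<in>{a..b}. norm (y-x) < d \<longrightarrow> norm (f y - f x - (y-x) *\<^sub>R f' x) \<le> e' * norm (y-x)))"
    proof
      fix x
      show "\<exists>d>0. (x \<in> N \<longrightarrow> ball x d \<subseteq> U) \<and> (x \<in> {a..b} - N \<longrightarrow>
           (\<forall>y\<in>{a..b}. norm (y-x) < d \<longrightarrow> norm (f y - f x - (y-x) *\<^sub>R f' x) \<le> e' * norm (y-x)))"
      proof (cases "x \<in> N")
        case True
        then show ?thesis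
          using U by (metis DiffD2 open_contains_ball subsetD)
      next
        case False
        show ?thesis
        proof cases
          assume "x \<in> {a..b}"
          then show ?thesis
            using der [of x] False \<open>e' > 0\<close>
            unfolding has_vector_derivative_def has_derivative_within_alt by blast
        next
          assume "x \<notin> {a..b}"
          then show ?thesis
            using False by (intro exI [of _ "1::real"]) auto
        qed
      qed
    qed
    then obtain d where d: "\<And>x. 0 < d x" "\<And>x. x \<in> N \<Longrightarrow> ball x (d x) \<subseteq> U"
      "\<And>x y. \<lbrakk>x \<in> {a..b} - N; y \<in> {a..b}; norm (y-x) < d x\<rbrakk>
          \<Longrightarrow> norm (f y - f x - (y-x) *\<^sub>R f' x) \<le> e' * norm (y-x)"
      by metis
    show "\<exists>\<gamma>. gauge \<gamma> \<and> (\<forall>\<D>. \<D> tagged_division_of {a..b} \<and> \<gamma> fine \<D> \<longrightarrow>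
            norm ((\<Sum>(x, k)\<in>\<D>. measure lborel k *\<^sub>R g x) - (f b - f a)) < e)"
    proof (rule exI, safe)
      show "gauge (\<lambda>x. ball x (d x))"
        using d(1) gauge_ball_dependent by blast
    next
      fix p
      assume ptag: "p tagged_division_of {a..b}" and finep: "(\<lambda>x. ball x (d x)) fine p"
      note pD = tagged_division_ofD [OF ptag]
      have ba: "b - a = (\<Sum>(x,K)\<in>p. Sup K - Inf K)" "f b - f a = (\<Sum>(x,K)\<in>p. f(Sup K) - f(Inf K))"
        using additive_tagged_division_1 [where f= "\<lambda>x. x"] additive_tagged_division_1 [where f= f]
          \<open>a \<le> b\<close> ptag by auto
      \<comment> \<open>Intervals tagged in \<open>N\<close> lie in \<open>U\<close>, so absolute continuity controls them;
        the others are controlled by the derivative.\<close>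
      define q where "q = {z \<in> p. fst z \<in> N}"
      have qp: "q \<subseteq> p" "finite p" by (auto simp: q_def pD)
      have qtag: "q tagged_partial_division_of {a..b}"
        using tagged_partial_division_subset [OF _ qp(1)] ptag by (simp add: tagged_division_of_def)
      have "(\<Sum>(x,K)\<in>q. Sup K - Inf K) < \<delta>"
      proof (rule le_less_trans [OF sum_tagged_partial_division_le_measure [OF qtag U(3)] U(4)])
        show "K \<subseteq> U" if "(x,K) \<in> q" for x K
        proof -
          have "x \<in> N" "K \<subseteq> ball x (d x)"
            using that finep by (auto simp: q_def fine_def)
          then show ?thesis
            using d(2) by blast
        qed
      qed
      then have q_small: "(\<Sum>(x,K)\<in>q. \<bar>f (Sup K) - f (Inf K)\<bar>) < e/2"
        using \<delta> [OF qtag] by simp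
      define E where "E z = measure lborel (snd z) * g (fst z) - (f (Sup (snd z)) - f (Inf (snd z)))" for z
      have "(\<Sum>(x, k)\<in>p. measure lborel k *\<^sub>R g x) - (f b - f a) = sum E p"
        by (simp add: ba(2) E_def case_prod_unfold sum_subtractf)
      also have "sum E p = sum E q + sum E (p - q)"
        using qp by (metis add.commute sum.subset_diff)
      finally have eq: "(\<Sum>(x, k)\<in>p. measure lborel k *\<^sub>R g x) - (f b - f a) = sum E q + sum E (p - q)" .
      have "\<bar>sum E q\<bar> \<le> (\<Sum>(x,K)\<in>q. \<bar>f (Sup K) - f (Inf K)\<bar>)"
        by (rule order_trans [OF sum_abs]) (auto intro!: sum_mono simp: E_def q_def g_def)
      moreover have "\<bar>sum E (p - q)\<bar> \<le> (\<Sum>(x,K)\<in>p. e' * (Sup K - Inf K))"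
      proof -
        have *: "\<bar>E (x,K)\<bar> \<le> e' * (Sup K - Inf K) \<and> 0 \<le> Sup K - Inf K" if xK: "(x,K) \<in> p" "x \<notin> N" for x K
        proof -
          obtain u v where K: "K = {u..v}"
            using pD(4) [OF xK(1)] by auto
          have x: "x \<in> K" "K \<subseteq> {a..b}"
            using pD(2,3) [OF xK(1)] by auto
          then have uv: "u \<le> x" "x \<le> v" "u \<in> K" "v \<in> K"
            by (auto simp: K)
          have "K \<subseteq> ball x (d x)"
            using finep xK by auto
          then have "u \<in> ball x (d x)" "v \<in> ball x (d x)"
            using uv by blast+
          then have "norm (u - x) < d x" "norm (v - x) < d x"
            by (simp_all add: dist_real_def)
          moreover have "x \<in> {a..b} - N" "u \<in> {a..b}" "v \<in> {a..b}"
            using uv x xK by blast+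
          ultimately have "norm (f u - f x - (u - x) *\<^sub>R f' x) \<le> e' * norm (u - x)"
            "norm (f v - f x - (v - x) *\<^sub>R f' x) \<le> e' * norm (v - x)"
            using d(3) by blast+
          then have "norm (f u - f x - (u - x) *\<^sub>R f' x) \<le> e' * (x - u)"
            "norm (f v - f x - (v - x) *\<^sub>R f' x) \<le> e' * (v - x)"
            using uv by simp_all
          \<comment> \<open>Straddling: as \<open>x\<close> lies between \<open>u\<close> and
            \<open>v\<close>, the two errors are at most \<open>e' * (x - u)\<close> and
            \<open>e' * (v - x)\<close>, which add up to \<open>e'\<close> times the length of
            \<open>K\<close>.\<close>
          moreover have "E (x,K) = (f u - f x - (u - x) * f' x) - (f v - f x - (v - x) * f' x)"
            using xK uv by (simp add: E_def g_def K algebra_simps)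
          ultimately have "\<bar>E (x,K)\<bar> \<le> e' * (x - u) + e' * (v - x)"
            by (simp add: real_norm_def)
          then show ?thesis
            using uv by (simp add: K algebra_simps)
        qed
        have "\<bar>sum E (p - q)\<bar> \<le> (\<Sum>(x,K)\<in>p - q. e' * (Sup K - Inf K))"
        proof (rule order_trans [OF sum_abs sum_mono])
          fix z assume "z \<in> p - q"
          then show "\<bar>E z\<bar> \<le> (case z of (x,K) \<Rightarrow> e' * (Sup K - Inf K))"
            using *[of "fst z" "snd z"] by (cases z) (auto simp: q_def)
        qed
        also have "\<dots> \<le> (\<Sum>(x,K)\<in>p. e' * (Sup K - Inf K))"
        proof (rule sum_mono2)
          fix z assume "z \<in> p - (p - q)"
          then obtain x K where xK: "z = (x,K)" "(x,K) \<in> p" by (cases z) auto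
          obtain u v where "K = {u..v}" "x \<in> K"
            using pD(2,4) [OF xK(2)] by auto
          then show "0 \<le> (case z of (x,K) \<Rightarrow> e' * (Sup K - Inf K))"
            using \<open>e' > 0\<close> by (auto simp: xK)
        qed (use qp in auto)
        finally show ?thesis .
      qed
      moreover have "(\<Sum>(x,K)\<in>p. e' * (Sup K - Inf K)) = e' * (b - a)"
        by (simp add: ba(1) sum_distrib_left case_prod_unfold)
      moreover have "e' * (b - a) \<le> e / 2"
      proof -
        have "e' * (b - a) \<le> e' * (b - a + 1)"
          using \<open>e' > 0\<close> by simp
        also have "\<dots> = e/2"
          using \<open>a \<le> b\<close> by (simp add: e'_def field_simps)
        finally show ?thesis .
      qed
      ultimately show "norm ((\<Sum>(x, k)\<in>p. measure lborel k *\<^sub>R g x) - (f b - f a)) < e"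
        unfolding eq using q_small by (simp add: real_norm_def)
    qed
  qed
  then show ?thesis
    by (rule has_integral_spike [OF N, rotated]) (simp add: g_def)
qed

section \<open>Closure properties of absolute continuity\<close>

lemma abs_continuous_on_interval_subset:
  assumes "abs_continuous_on_interval a b f" "a \<le> c" "d \<le> b"
  shows "abs_continuous_on_interval c d f"
  unfolding abs_continuous_on_interval_def
proof (intro allI impI)
  fix \<epsilon> :: real assume "\<epsilon> > 0"
  then obtain \<delta> where "\<delta> > 0" and \<delta>: "\<forall>(N::nat) u v. (\<forall>i<N. a \<le> u i \<and> u i \<le> v i \<and> v i \<le> b) \<and>
        disjoint_family_on (\<lambda>i. {u i<..<v i}) {..<N} \<and> (\<Sum>i<N. v i - u i) < \<delta> \<longrightarrow>
        (\<Sum>i<N. \<bar>f (v i) - f (u i)\<bar>) < \<epsilon>"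
    using assms(1) unfolding abs_continuous_on_interval_def by blast
  show "\<exists>\<delta>>0. \<forall>(N::nat) u v. (\<forall>i<N. c \<le> u i \<and> u i \<le> v i \<and> v i \<le> d) \<and>
        disjoint_family_on (\<lambda>i. {u i<..<v i}) {..<N} \<and> (\<Sum>i<N. v i - u i) < \<delta> \<longrightarrow>
        (\<Sum>i<N. \<bar>f (v i) - f (u i)\<bar>) < \<epsilon>"
  proof (intro exI conjI allI impI)
    fix N :: nat and u v
    assume *: "(\<forall>i<N. c \<le> u i \<and> u i \<le> v i \<and> v i \<le> d) \<and>
        disjoint_family_on (\<lambda>i. {u i<..<v i}) {..<N} \<and> (\<Sum>i<N. v i - u i) < \<delta>"
    then have "\<forall>i<N. a \<le> u i \<and> u i \<le> v i \<and> v i \<le> b"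
      using assms(2,3) by (meson order_trans)
    with * show "(\<Sum>i<N. \<bar>f (v i) - f (u i)\<bar>) < \<epsilon>"
      using \<delta> by blast
  qed fact
qed

text \<open>One estimate behind several closure properties: \<open>C = 0\<close> gives Lipschitz
  functions, \<open>L = 0\<close> constant multiples, and both terms together give products with
  polynomials.\<close>

lemma abs_continuous_on_interval_dominated:
  assumes f: "abs_continuous_on_interval a b f" and "C \<ge> 0" "L \<ge> 0"
    and le: "\<And>x y. a \<le> x \<Longrightarrow> x \<le> y \<Longrightarrow> y \<le> b \<Longrightarrow> \<bar>g y - g x\<bar> \<le> C * \<bar>f y - f x\<bar> + L * (y - x)"
  shows "abs_continuous_on_interval a b g"
  unfolding abs_continuous_on_interval_def
proof (intro allI impI)
  fix \<epsilon> :: real assume "\<epsilon> > 0"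
  \<comment> \<open>Each of the two terms of the bound receives half of the tolerance. Dividing by
    \<open>C + 1\<close>, and below by \<open>L + 1\<close>, is safe even if \<open>C\<close> or
    \<open>L\<close> is zero.\<close>
  define \<epsilon>' where "\<epsilon>' = \<epsilon> / (2 * (C + 1))"
  have "\<epsilon>' > 0" "C * \<epsilon>' \<le> \<epsilon> / 2"
    using \<open>\<epsilon> > 0\<close> \<open>C \<ge> 0\<close> by (auto simp: \<epsilon>'_def field_simps)
  then obtain \<delta> where "\<delta> > 0" and \<delta>: "\<forall>(N::nat) u v. (\<forall>i<N. a \<le> u i \<and> u i \<le> v i \<and> v i \<le> b) \<and>
        disjoint_family_on (\<lambda>i. {u i<..<v i}) {..<N} \<and> (\<Sum>i<N. v i - u i) < \<delta> \<longrightarrow>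
        (\<Sum>i<N. \<bar>f (v i) - f (u i)\<bar>) < \<epsilon>'"
    using f unfolding abs_continuous_on_interval_def by blast
  define \<delta>' where "\<delta>' = min \<delta> (\<epsilon> / (2 * (L + 1)))"
  have "\<delta>' > 0"
    using \<open>\<delta> > 0\<close> \<open>\<epsilon> > 0\<close> \<open>L \<ge> 0\<close> by (auto simp: \<delta>'_def)
  show "\<exists>\<delta>>0. \<forall>(N::nat) u v. (\<forall>i<N. a \<le> u i \<and> u i \<le> v i \<and> v i \<le> b) \<and>
        disjoint_family_on (\<lambda>i. {u i<..<v i}) {..<N} \<and> (\<Sum>i<N. v i - u i) < \<delta> \<longrightarrow>
        (\<Sum>i<N. \<bar>g (v i) - g (u i)\<bar>) < \<epsilon>"
  proof (intro exI conjI allI impI)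
    fix N :: nat and u v
    assume *: "(\<forall>i<N. a \<le> u i \<and> u i \<le> v i \<and> v i \<le> b) \<and>
        disjoint_family_on (\<lambda>i. {u i<..<v i}) {..<N} \<and> (\<Sum>i<N. v i - u i) < \<delta>'"
    then have f_small: "(\<Sum>i<N. \<bar>f (v i) - f (u i)\<bar>) < \<epsilon>'"
      using \<delta> by (simp add: \<delta>'_def)
    have small: "0 \<le> (\<Sum>i<N. v i - u i)" "(\<Sum>i<N. v i - u i) < \<epsilon> / (2 * (L + 1))"
      using * by (auto simp: \<delta>'_def intro!: sum_nonneg)
    have "L * (\<Sum>i<N. v i - u i) \<le> (L + 1) * (\<Sum>i<N. v i - u i)"
      using small by (simp add: algebra_simps)
    also have "\<dots> < \<epsilon> / 2"
      using small \<open>L \<ge> 0\<close> by (simp add: field_simps)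
    finally have L: "L * (\<Sum>i<N. v i - u i) < \<epsilon> / 2" .
    have "(\<Sum>i<N. \<bar>g (v i) - g (u i)\<bar>) \<le> (\<Sum>i<N. C * \<bar>f (v i) - f (u i)\<bar> + L * (v i - u i))"
      using * by (intro sum_mono le) auto
    also have "\<dots> = C * (\<Sum>i<N. \<bar>f (v i) - f (u i)\<bar>) + L * (\<Sum>i<N. v i - u i)"
      by (simp add: sum.distrib sum_distrib_left)
    also have "\<dots> < \<epsilon>"
      using mult_left_mono [OF less_imp_le [OF f_small] \<open>C \<ge> 0\<close>] \<open>C * \<epsilon>' \<le> \<epsilon> / 2\<close> L by linarith
    finally show "(\<Sum>i<N. \<bar>g (v i) - g (u i)\<bar>) < \<epsilon>" .
  qed fact
qed

lemma abs_continuous_on_interval_const: "abs_continuous_on_interval a b (\<lambda>x. c)"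
  by (auto simp: abs_continuous_on_interval_def intro!: exI [of _ 1])

lemma abs_continuous_on_interval_lipschitz:
  assumes "L \<ge> 0" "\<And>x y. a \<le> x \<Longrightarrow> x \<le> y \<Longrightarrow> y \<le> b \<Longrightarrow> \<bar>g y - g x\<bar> \<le> L * (y - x)"
  shows "abs_continuous_on_interval a b g"
  by (rule abs_continuous_on_interval_dominated [OF abs_continuous_on_interval_const [of a b 0], of 0 L])
    (use assms in auto)

lemma abs_continuous_on_interval_add:
  assumes "abs_continuous_on_interval a b f" "abs_continuous_on_interval a b g"
  shows "abs_continuous_on_interval a b (\<lambda>x. f x + g x)"
  unfolding abs_continuous_on_interval_def
proof (intro allI impI)
  fix \<epsilon> :: real assume "\<epsilon> > 0"
  then have e2: "\<epsilon> / 2 > 0" by simp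
  obtain \<delta>1 where "\<delta>1 > 0" and \<delta>1: "\<forall>(N::nat) u v. (\<forall>i<N. a \<le> u i \<and> u i \<le> v i \<and> v i \<le> b) \<and>
        disjoint_family_on (\<lambda>i. {u i<..<v i}) {..<N} \<and> (\<Sum>i<N. v i - u i) < \<delta>1 \<longrightarrow>
        (\<Sum>i<N. \<bar>f (v i) - f (u i)\<bar>) < \<epsilon> / 2"
    using assms(1) e2 unfolding abs_continuous_on_interval_def by blast
  obtain \<delta>2 where "\<delta>2 > 0" and \<delta>2: "\<forall>(N::nat) u v. (\<forall>i<N. a \<le> u i \<and> u i \<le> v i \<and> v i \<le> b) \<and>
        disjoint_family_on (\<lambda>i. {u i<..<v i}) {..<N} \<and> (\<Sum>i<N. v i - u i) < \<delta>2 \<longrightarrow>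
        (\<Sum>i<N. \<bar>g (v i) - g (u i)\<bar>) < \<epsilon> / 2"
    using assms(2) e2 unfolding abs_continuous_on_interval_def by blast
  show "\<exists>\<delta>>0. \<forall>(N::nat) u v. (\<forall>i<N. a \<le> u i \<and> u i \<le> v i \<and> v i \<le> b) \<and>
        disjoint_family_on (\<lambda>i. {u i<..<v i}) {..<N} \<and> (\<Sum>i<N. v i - u i) < \<delta> \<longrightarrow>
        (\<Sum>i<N. \<bar>(f (v i) + g (v i)) - (f (u i) + g (u i))\<bar>) < \<epsilon>"
  proof (intro exI conjI allI impI)
    show "min \<delta>1 \<delta>2 > 0"
      using \<open>\<delta>1 > 0\<close> \<open>\<delta>2 > 0\<close> by simp
    fix N :: nat and u v
    assume *: "(\<forall>i<N. a \<le> u i \<and> u i \<le> v i \<and> v i \<le> b) \<and>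
        disjoint_family_on (\<lambda>i. {u i<..<v i}) {..<N} \<and> (\<Sum>i<N. v i - u i) < min \<delta>1 \<delta>2"
    have "(\<Sum>i<N. \<bar>(f (v i) + g (v i)) - (f (u i) + g (u i))\<bar>)
      \<le> (\<Sum>i<N. \<bar>f (v i) - f (u i)\<bar> + \<bar>g (v i) - g (u i)\<bar>)"
      by (intro sum_mono) linarith
    also have "\<dots> = (\<Sum>i<N. \<bar>f (v i) - f (u i)\<bar>) + (\<Sum>i<N. \<bar>g (v i) - g (u i)\<bar>)"
      by (simp add: sum.distrib)
    also have "\<dots> < \<epsilon> / 2 + \<epsilon> / 2"
      using \<delta>1 [rule_format, of N u v] \<delta>2 [rule_format, of N u v] * by (intro add_strict_mono) auto
    finally show "(\<Sum>i<N. \<bar>(f (v i) + g (v i)) - (f (u i) + g (u i))\<bar>) < \<epsilon>" by simp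
  qed
qed

lemma abs_continuous_on_interval_sum:
  assumes "finite I" "\<And>i. i \<in> I \<Longrightarrow> abs_continuous_on_interval a b (f i)"
  shows "abs_continuous_on_interval a b (\<lambda>x. \<Sum>i\<in>I. f i x)"
  using assms
  by (induction I rule: finite_induct)
    (auto intro: abs_continuous_on_interval_const abs_continuous_on_interval_add)

lemma abs_continuous_on_interval_imp_continuous_on:
  assumes f: "abs_continuous_on_interval a b f"
  shows "continuous_on {a..b} f"
  unfolding continuous_on_iff
proof (intro ballI allI impI)
  fix x e :: real assume x: "x \<in> {a..b}" and "e > 0"
  then obtain \<delta> where "\<delta> > 0" and \<delta>: "\<forall>(N::nat) u v. (\<forall>i<N. a \<le> u i \<and> u i \<le> v i \<and> v i \<le> b) \<and>
        disjoint_family_on (\<lambda>i. {u i<..<v i}) {..<N} \<and> (\<Sum>i<N. v i - u i) < \<delta> \<longrightarrow>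
        (\<Sum>i<N. \<bar>f (v i) - f (u i)\<bar>) < e"
    using f unfolding abs_continuous_on_interval_def by blast
  have step: "\<bar>f z - f y\<bar> < e" if "a \<le> y" "y \<le> z" "z \<le> b" "z - y < \<delta>" for y z
    using \<delta> [rule_format, of "Suc 0" "\<lambda>_. y" "\<lambda>_. z"] that by (simp add: disjoint_family_on_def)
  show "\<exists>d>0. \<forall>y\<in>{a..b}. dist y x < d \<longrightarrow> dist (f y) (f x) < e"
  proof (intro exI conjI ballI impI)
    fix y assume "y \<in> {a..b}" "dist y x < \<delta>"
    then show "dist (f y) (f x) < e"
      using step [of x y] step [of y x] x by (cases "x \<le> y") (auto simp: dist_real_def)
  qed fact
qed

lemma continuous_on_interval_bounded:
  fixes f :: "real \<Rightarrow> real"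
  assumes "continuous_on {a..b} f"
  obtains B where "B \<ge> 0" "\<And>x. x \<in> {a..b} \<Longrightarrow> \<bar>f x\<bar> \<le> B"
proof -
  have "bounded (f ` {a..b})"
    by (intro compact_imp_bounded compact_continuous_image assms compact_Icc)
  then obtain B where "\<forall>x\<in>{a..b}. \<bar>f x\<bar> \<le> B"
    unfolding bounded_iff by auto
  then show ?thesis
    by (intro that [of "max B 0"]) (auto simp: le_max_iff_disj)
qed

text \<open>Split the increment of the product as in the product rule. Both factors are bounded on
  the compact interval, and the polynomial is Lipschitz by the mean value theorem.\<close>

lemma abs_continuous_on_interval_mult_poly:
  fixes p :: "real poly"
  assumes f: "abs_continuous_on_interval a b f"
  shows "abs_continuous_on_interval a b (\<lambda>x. f x * poly p x)"
proof -
  obtain B where B: "B \<ge> 0" "\<And>x. x \<in> {a..b} \<Longrightarrow> \<bar>f x\<bar> \<le> B"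
    using continuous_on_interval_bounded [OF abs_continuous_on_interval_imp_continuous_on [OF f]] by blast
  obtain C where C: "C \<ge> 0" "\<And>x. x \<in> {a..b} \<Longrightarrow> \<bar>poly p x\<bar> \<le> C"
    using continuous_on_interval_bounded [OF continuous_on_poly [OF continuous_on_id], of a b p] by blast
  obtain L where L: "L \<ge> 0" "\<And>x. x \<in> {a..b} \<Longrightarrow> \<bar>poly (pderiv p) x\<bar> \<le> L"
    using continuous_on_interval_bounded [OF continuous_on_poly [OF continuous_on_id], of a b "pderiv p"] by blast
  show ?thesis
  proof (rule abs_continuous_on_interval_dominated [OF f \<open>C \<ge> 0\<close>])
    show "B * L \<ge> 0"
      using B L by simp
    fix x y assume xy: "a \<le> x" "x \<le> y" "y \<le> b"
    have lip: "\<bar>poly p y - poly p x\<bar> \<le> L * (y - x)"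
    proof (cases "x < y")
      case True
      then obtain z where "x < z" "z < y" "poly p y - poly p x = (y - x) * poly (pderiv p) z"
        using poly_MVT by blast
      then show ?thesis
        using L(2) [of z] xy by (simp add: abs_mult mult.commute [of L] mult_left_mono)
    qed (use xy in auto)
    have "f y * poly p y - f x * poly p x = poly p y * (f y - f x) + f x * (poly p y - poly p x)"
      by (simp add: algebra_simps)
    then have "\<bar>f y * poly p y - f x * poly p x\<bar> \<le> \<bar>poly p y\<bar> * \<bar>f y - f x\<bar> + \<bar>f x\<bar> * \<bar>poly p y - poly p x\<bar>"
      by (metis abs_mult abs_triangle_ineq)
    also have "\<dots> \<le> C * \<bar>f y - f x\<bar> + B * (L * (y - x))"
      using B C xy lip by (intro add_mono mult_mono mult_right_mono) auto
    finally show "\<bar>f y * poly p y - f x * poly p x\<bar> \<le> C * \<bar>f y - f x\<bar> + B * L * (y - x)"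
      by simp
  qed
qed

subsection \<open>Iterated integration by parts\<close>

text \<open>\<open>u j\<close> plays the derivative of order \<open>j\<close> of \<open>u 0\<close>.
  Encoding it as a sequence lets one integration by parts serve members of \<open>W2_ring n\<close>,
  polynomials and iterated primitives alike; the last derivative is prescribed off a null
  set.\<close>

definition deriv_chain :: "nat \<Rightarrow> (nat \<Rightarrow> real \<Rightarrow> real) \<Rightarrow> bool" where
  "deriv_chain n u \<longleftrightarrow>
     (\<forall>j. Suc j < n \<longrightarrow> (\<forall>x\<in>{0..1}. (u j has_vector_derivative u (Suc j) x) (at x within {0..1}))) \<and>
     (\<forall>j<n. abs_continuous_on_interval 0 1 (u j)) \<and>
     (\<exists>N. negligible N \<and>
        (\<forall>x\<in>{0..1} - N. (u (n - 1) has_vector_derivative u n x) (at x within {0..1})))"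

definition parts_boundary :: "nat \<Rightarrow> (nat \<Rightarrow> real \<Rightarrow> real) \<Rightarrow> real poly \<Rightarrow> real \<Rightarrow> real" where
  "parts_boundary n u q x = (\<Sum>j<n. (-1)^j * (u (n - 1 - j) x * poly ((pderiv ^^ j) q) x))"

text \<open>The whole boundary sum has the integrand as its derivative off a null set, so a single
  use of the fundamental theorem replaces \<open>n\<close> successive partial integrations.\<close>

lemma iterated_integration_by_parts:
  assumes u: "deriv_chain n u" and cd: "0 \<le> c" "c \<le> d" "d \<le> 1" and "n \<ge> 1"
  shows "((\<lambda>x. u n x * poly q x - (-1)^n * (u 0 x * poly ((pderiv ^^ n) q) x)) has_integral
           (parts_boundary n u q d - parts_boundary n u q c)) {c..d}"
proof -
  obtain N where N: "negligible N" and
    uN: "\<And>x. x \<in> {0..1} - N \<Longrightarrow> (u (n - 1) has_vector_derivative u n x) (at x within {0..1})"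
    using u unfolding deriv_chain_def by blast
  have der: "(u j has_vector_derivative u (Suc j) x) (at x within {c..d})"
    if "j < n" "x \<in> {c..d} - N" for j x
  proof (rule has_vector_derivative_within_subset)
    show "(u j has_vector_derivative u (Suc j) x) (at x within {0..1})"
    proof (cases "Suc j < n")
      case True
      then show ?thesis
        using u that cd unfolding deriv_chain_def by auto
    next
      case False
      then have "n - 1 = j" "n = Suc j"
        using that by auto
      then show ?thesis
        using uN [of x] that cd by auto
    qed
  qed (use cd in auto)
  have ac: "abs_continuous_on_interval c d (u j)" if "j < n" for j
    using u that cd unfolding deriv_chain_def by (blast intro: abs_continuous_on_interval_subset)
  show ?thesis
  proof (rule fundamental_theorem_of_calculus_abs_continuous [OF \<open>c \<le> d\<close> _ N])
    \<comment> \<open>The sign is moved into the polynomial, so that each summand is an absolutely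
      continuous function times a polynomial.\<close>
    have "parts_boundary n u q = (\<lambda>x. \<Sum>j<n. u (n - 1 - j) x * poly (smult ((-1)^j) ((pderiv ^^ j) q)) x)"
      by (auto simp: parts_boundary_def fun_eq_iff intro!: sum.cong)
    then show "abs_continuous_on_interval c d (parts_boundary n u q)"
      by (simp only:) (intro abs_continuous_on_interval_sum abs_continuous_on_interval_mult_poly ac; simp)
    fix x assume x: "x \<in> {c..d} - N"
    \<comment> \<open>The product rule turns the boundary term of index \<open>j\<close> into
      \<open>a j - a (Suc j)\<close>. The sum telescopes to \<open>a 0 - a n\<close>, which is the
      integrand.\<close>
    define a where "a j = (-1)^j * (u (n - j) x * poly ((pderiv ^^ j) q) x)" for j
    have "((\<lambda>y. (-1)^j * (u (n - 1 - j) y * poly ((pderiv ^^ j) q) y)) has_vector_derivative (a j - a (Suc j)))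
        (at x within {c..d})" if "j < n" for j
    proof -
      have "n - j = Suc (n - Suc j)"
        using that by simp
      then have "(u (n - 1 - j) has_real_derivative u (n - j) x) (at x within {c..d})"
        using der [of "n - 1 - j" x] that x by (simp add: has_real_derivative_iff_has_vector_derivative)
      note this [derivative_intros]
      have "(poly ((pderiv ^^ j) q) has_real_derivative poly ((pderiv ^^ Suc j) q) x) (at x within {c..d})"
        using poly_DERIV DERIV_subset by (simp add: has_field_derivative_at_within)
      note this [derivative_intros]
      show ?thesis
        unfolding has_real_derivative_iff_has_vector_derivative [symmetric]
        by (rule derivative_eq_intros refl)+ (simp add: a_def algebra_simps)
    qed
    then have "((\<lambda>y. \<Sum>j<n. (-1)^j * (u (n - 1 - j) y * poly ((pderiv ^^ j) q) y)) has_vector_derivative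
        (\<Sum>j<n. a j - a (Suc j))) (at x within {c..d})"
      by (intro has_vector_derivative_sum) auto
    moreover have "(\<Sum>j<n. a j - a (Suc j)) = a 0 - a n"
      by (rule sum_lessThan_telescope')
    ultimately show "(parts_boundary n u q has_vector_derivative
        (u n x * poly q x - (- 1) ^ n * (u 0 x * poly ((pderiv ^^ n) q) x))) (at x within {c..d})"
      by (simp add: a_def parts_boundary_def [abs_def])
  qed
qed

lemma deriv_chain_poly:
  assumes "n \<ge> 1"
  shows "deriv_chain n (\<lambda>j. poly ((pderiv ^^ j) U))"
proof -
  have "abs_continuous_on_interval 0 1 (poly p)" for p :: "real poly"
    using abs_continuous_on_interval_mult_poly [OF abs_continuous_on_interval_const [of 0 1 1], of p] by simp
  moreover have "(poly ((pderiv ^^ j) U) has_vector_derivative poly ((pderiv ^^ Suc j) U) x) (at x within {0..1})" for j x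
    using poly_DERIV by (simp add: has_field_derivative_at_within flip: has_real_derivative_iff_has_vector_derivative)
  moreover have "\<exists>N. negligible N \<and>
        (\<forall>x\<in>{0..1} - N. (poly ((pderiv ^^ (n - 1)) U) has_vector_derivative poly ((pderiv ^^ n) U) x) (at x within {0..1}))"
    using calculation(2) [of "n - 1"] assms by (intro exI [of _ "{}"]) auto
  ultimately show ?thesis
    unfolding deriv_chain_def
    by simp
qed

lemma parts_boundary_eq_0:
  assumes "\<And>j. j < n \<Longrightarrow> u j x = 0"
  shows "parts_boundary n u q x = 0"
  using assms by (auto simp: parts_boundary_def intro!: sum.neutral)

lemma higher_pderiv_eq_0:
  fixes q :: "real poly"
  assumes "degree q < n"
  shows "(pderiv ^^ n) q = 0"
  using assms by (intro poly_eqI) (simp add: coeff_higher_pderiv coeff_eq_0)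

lemma has_integral_by_parts_vanishing:
  assumes u: "deriv_chain n u" and cd: "0 \<le> c" "c \<le> d" "d \<le> 1" and q: "degree q < n"
  shows "((\<lambda>x. u n x * poly q x) has_integral
           (parts_boundary n u q d - parts_boundary n u q c)) {c..d}"
proof -
  show ?thesis
    using iterated_integration_by_parts [OF u cd, of q] q by (simp add: higher_pderiv_eq_0)
qed

text \<open>The kernel of Taylor's formula, normalized so that differentiation only lowers
  \<open>r\<close> and changes the sign. The truncation at \<open>a\<close> is not part of the
  polynomial; it enters by integrating over \<open>{0..a}\<close>.\<close>

definition trunc_kernel :: "nat \<Rightarrow> real \<Rightarrow> real poly" where
  "trunc_kernel r a = smult (1 / fact r) ([:a, -1:] ^ r)"

lemma poly_trunc_kernel: "poly (trunc_kernel r a) x = (a - x) ^ r / fact r"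
  by (simp add: trunc_kernel_def)

lemma degree_trunc_kernel: "degree (trunc_kernel r a) = r"
  by (simp add: trunc_kernel_def degree_power_eq)

lemma pderiv_trunc_kernel_Suc: "pderiv (trunc_kernel (Suc r) a) = - trunc_kernel r a"
proof -
  have "pderiv ([:a, -1:] ^ Suc r) = smult (- of_nat (Suc r)) ([:a, -1:] ^ r)"
    by (simp only: pderiv_power_Suc) (simp add: pderiv_pCons)
  moreover have "- of_nat (Suc r) / fact (Suc r) = - (1 / fact r :: real)"
    by (simp add: divide_simps)
  ultimately show ?thesis
    by (simp add: trunc_kernel_def pderiv_smult del: power_Suc fact_Suc of_nat_Suc flip: smult_minus_left)
qed

lemma higher_pderiv_trunc_kernel:
  "j \<le> r \<Longrightarrow> (pderiv ^^ j) (trunc_kernel r a) = smult ((-1) ^ j) (trunc_kernel (r - j) a)"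
proof (induction j)
  case (Suc j)
  then have "r - j = Suc (r - Suc j)" by simp
  with Suc show ?case
    by (simp add: pderiv_smult pderiv_trunc_kernel_Suc)
qed simp

lemma poly_higher_pderiv_trunc_kernel:
  "poly ((pderiv ^^ j) (trunc_kernel r a)) a = (if j = r then (-1) ^ r else 0)"
proof (cases "j \<le> r")
  case True
  then show ?thesis
    by (auto simp: higher_pderiv_trunc_kernel poly_trunc_kernel power_0_left)
next
  case False
  then show ?thesis
    by (simp add: higher_pderiv_eq_0 degree_trunc_kernel)
qed

text \<open>At \<open>a\<close> the only nonzero derivative of the kernel is the one of order
  \<open>r\<close>, and its sign cancels that of the boundary term. This is how evaluation of a
  derivative at \<open>a\<close> becomes an integral.\<close>

lemma parts_boundary_trunc_kernel:
  assumes "r < n"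
  shows "parts_boundary n u (trunc_kernel r a) a = u (n - 1 - r) a"
proof -
  have "parts_boundary n u (trunc_kernel r a) a
      = (\<Sum>j<n. if j = r then (-1)^j * (u (n - 1 - j) a * (-1)^r) else 0)"
    unfolding parts_boundary_def by (intro sum.cong) (auto simp: poly_higher_pderiv_trunc_kernel)
  also have "\<dots> = (-1)^r * (u (n - 1 - r) a * (-1)^r)"
    using assms by simp
  also have "\<dots> = u (n - 1 - r) a * ((-1)^r * (-1)^r)"
    by (simp add: algebra_simps)
  also have "\<dots> = u (n - 1 - r) a"
    by (simp flip: power_add)
  finally show ?thesis .
qed

text \<open>Each differentiation costs at most one power of the linear factor, so at least one is
  left after \<open>j < n\<close> of them.\<close>

lemma poly_higher_pderiv_eq_0:
  fixes U :: "real poly"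
  assumes "[:- c, 1:] ^ n dvd U" "j < n"
  shows "poly ((pderiv ^^ j) U) c = 0"
proof -
  have "[:- c, 1:] ^ (n - j) dvd (pderiv ^^ j) U"
    using assms(2)
  proof (induction j)
    case (Suc j)
    then obtain V where V: "(pderiv ^^ j) U = [:- c, 1:] ^ (n - j) * V"
      by (meson Suc_lessD dvdE)
    define X where "X = [:- c, 1:]"
    define l where "l = n - Suc j"
    have "n - j = Suc l"
      using Suc by (simp add: l_def)
    then have "pderiv ((pderiv ^^ j) U) = X ^ Suc l * pderiv V + V * (smult (of_nat (Suc l)) (X ^ l) * pderiv X)"
      by (simp only: V X_def pderiv_mult pderiv_power_Suc)
    also have "\<dots> = X ^ l * (X * pderiv V + V * smult (of_nat (Suc l)) (pderiv X))"
      by (simp add: algebra_simps)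
    finally have "X ^ l dvd pderiv ((pderiv ^^ j) U)"
      by simp
    then show ?case
      by (simp add: X_def l_def)
  qed (use assms in simp)
  then have "[:- c, 1:] dvd (pderiv ^^ j) U"
    using assms(2) by (metis dvd_power dvd_trans zero_less_diff)
  then show ?thesis
    by (simp add: poly_eq_0_iff_dvd)
qed

section \<open>Integrals of polynomials\<close>

definition poly_integral :: "real \<Rightarrow> real \<Rightarrow> real poly \<Rightarrow> real" where
  "poly_integral c d p = integral {c..d} (poly p)"

lemma poly_integrable: "poly p integrable_on {c..d}" for p :: "real poly"
  by (intro integrable_continuous_interval continuous_on_poly continuous_on_id)

lemma poly_integral_add: "poly_integral c d (p + q) = poly_integral c d p + poly_integral c d q"
proof -
  have "poly (p + q) = (\<lambda>x. poly p x + poly q x)" by auto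
  then show ?thesis
    by (simp add: poly_integral_def integral_add poly_integrable)
qed

lemma poly_integral_smult: "poly_integral c d (smult k p) = k * poly_integral c d p"
proof -
  have "poly (smult k p) = (\<lambda>x. k * poly p x)" by auto
  then show ?thesis
    by (simp add: poly_integral_def)
qed

lemma poly_integral_minus: "poly_integral c d (- p) = - poly_integral c d p"
  using poly_integral_smult [of c d "-1" p] by simp

lemma poly_integral_diff: "poly_integral c d (p - q) = poly_integral c d p - poly_integral c d q"
  using poly_integral_add [of c d p "- q"] by (simp add: poly_integral_minus)

lemma poly_integral_0 [simp]: "poly_integral c d 0 = 0"
  using poly_integral_smult [of c d 0 0] by simp

lemma poly_integral_split:
  assumes "c \<le> d" "d \<le> e"
  shows "poly_integral c e p = poly_integral c d p + poly_integral d e p"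
  using Henstock_Kurzweil_Integration.integral_combine [OF assms poly_integrable] by (simp add: poly_integral_def)

lemma poly_integral_by_parts:
  assumes cd: "0 \<le> c" "c \<le> d" "d \<le> 1" and n: "n \<ge> 1"
  shows "poly_integral c d ((pderiv ^^ n) U * q) =
    parts_boundary n (\<lambda>j. poly ((pderiv ^^ j) U)) q d - parts_boundary n (\<lambda>j. poly ((pderiv ^^ j) U)) q c
    + (-1) ^ n * poly_integral c d (U * (pderiv ^^ n) q)"
proof -
  have "(poly ((pderiv ^^ n) U * q - smult ((-1) ^ n) (U * (pderiv ^^ n) q)) has_integral
     parts_boundary n (\<lambda>j. poly ((pderiv ^^ j) U)) q d - parts_boundary n (\<lambda>j. poly ((pderiv ^^ j) U)) q c) {c..d}"
    using iterated_integration_by_parts [OF deriv_chain_poly [OF n] cd n, of U q]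
    by (rule has_integral_eq [rotated]) simp
  then have "poly_integral c d ((pderiv ^^ n) U * q - smult ((-1) ^ n) (U * (pderiv ^^ n) q)) =
     parts_boundary n (\<lambda>j. poly ((pderiv ^^ j) U)) q d - parts_boundary n (\<lambda>j. poly ((pderiv ^^ j) U)) q c"
    unfolding poly_integral_def by (rule integral_unique)
  then show ?thesis
    by (simp add: poly_integral_diff poly_integral_smult)
qed

subsection \<open>Projection of the truncated power to polynomials\<close>

lemma integral_power_mult_power_complement:
  assumes "n \<ge> 1"
  shows "integral {0..1} (\<lambda>x::real. x ^ n * (1 - x) ^ n) = (fact n)\<^sup>2 / fact (2 * n + 1)"
proof -
  have "((\<lambda>x. x powr (real n + 1 - 1) * (1 - x) powr (real n + 1 - 1)) has_integral Beta (real n + 1) (real n + 1)) {0..1}"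
    by (rule has_integral_Beta_real) auto
  \<comment> \<open>\<open>0 powr 0 = 0\<close> but \<open>0 ^ 0 = 1\<close>; with
    \<open>n \<ge> 1\<close> the two kinds of power agree at the endpoints as well.\<close>
  then have "((\<lambda>x. x ^ n * (1 - x) ^ n) has_integral Beta (real n + 1) (real n + 1)) {0..1}"
    by (rule has_integral_eq [rotated]) (use assms in \<open>simp add: powr_realpow'\<close>)
  moreover have "Beta (real n + 1) (real n + 1) = (fact n)\<^sup>2 / fact (2 * n + 1)"
    using Gamma_fact [of n, where 'a=real] Gamma_fact [of "2 * n + 1", where 'a=real]
    by (simp add: Beta_def power2_eq_square algebra_simps)
  ultimately show ?thesis
    by (simp add: integral_unique)
qed

definition endpoint_poly :: "nat \<Rightarrow> real poly" where
  "endpoint_poly n = [:0, -1, 1:] ^ n"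

text \<open>Rodrigues' formula without its factor: this is \<open>fact n\<close> times the Legendre
  polynomial transplanted to the unit interval.\<close>

definition shifted_legendre :: "nat \<Rightarrow> real poly" where
  "shifted_legendre n = (pderiv ^^ n) (endpoint_poly n)"

lemma degree_endpoint_poly: "degree (endpoint_poly n) = 2 * n"
  by (simp add: endpoint_poly_def degree_power_eq)

lemma lead_coeff_endpoint_poly: "coeff (endpoint_poly n) (2 * n) = 1"
  using lead_coeff_power [of "[:0, -1, 1:] :: real poly" n] degree_endpoint_poly [of n]
  by (simp add: endpoint_poly_def)

lemma endpoint_poly_factor: "endpoint_poly n = [:- 0, 1:] ^ n * [:- 1, 1:] ^ n"
  by (simp add: endpoint_poly_def flip: power_mult_distrib)

lemma higher_pderiv_endpoint_poly_0 [simp]: "j < n \<Longrightarrow> poly ((pderiv ^^ j) (endpoint_poly n)) 0 = 0"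
  by (rule poly_higher_pderiv_eq_0 [of 0 n]) (unfold endpoint_poly_factor, simp_all only: dvd_triv_left)

lemma higher_pderiv_endpoint_poly_1 [simp]: "j < n \<Longrightarrow> poly ((pderiv ^^ j) (endpoint_poly n)) 1 = 0"
  by (rule poly_higher_pderiv_eq_0 [of 1 n]) (unfold endpoint_poly_factor, simp_all only: dvd_triv_right)

lemma poly_integral_shifted_legendre:
  assumes "n \<ge> 1"
  shows "poly_integral 0 1 (shifted_legendre n * q) = (-1) ^ n * poly_integral 0 1 (endpoint_poly n * (pderiv ^^ n) q)"
  unfolding shifted_legendre_def
  by (subst poly_integral_by_parts) (use assms in \<open>simp_all add: parts_boundary_eq_0\<close>)

lemma shifted_legendre_orthogonal:
  assumes "degree q < n"
  shows "poly_integral 0 1 (shifted_legendre n * q) = 0"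
  using assms by (simp add: poly_integral_shifted_legendre higher_pderiv_eq_0)

lemma degree_shifted_legendre: "degree (shifted_legendre n) = n"
  by (simp add: shifted_legendre_def degree_higher_pderiv degree_endpoint_poly)

text \<open>Moving \<open>n\<close> derivatives across produces the derivative of order
  \<open>2 * n\<close> of a monic polynomial of that degree, the constant
  \<open>fact (2 * n)\<close>, times the Beta integral of \<open>endpoint_poly n\<close>.\<close>

lemma shifted_legendre_norm:
  assumes "n \<ge> 1"
  shows "poly_integral 0 1 (shifted_legendre n * shifted_legendre n) = (fact n)\<^sup>2 / (2 * real n + 1)"
proof -
  have "(pderiv ^^ n) (shifted_legendre n) = (pderiv ^^ (2 * n)) (endpoint_poly n)"
    by (simp add: shifted_legendre_def mult_2 funpow_add)
  also have "\<dots> = [:fact (2 * n):]"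
  proof (rule poly_eqI)
    fix k
    show "coeff ((pderiv ^^ (2 * n)) (endpoint_poly n)) k = coeff [:fact (2 * n):] k"
      by (cases k) (simp_all add: coeff_higher_pderiv lead_coeff_endpoint_poly coeff_eq_0
          degree_endpoint_poly pochhammer_fact)
  qed
  finally have D: "(pderiv ^^ n) (shifted_legendre n) = [:fact (2 * n):]" .
  have "(-1) ^ n * poly (endpoint_poly n) x = x ^ n * (1 - x) ^ n" for x
    by (simp add: endpoint_poly_def algebra_simps flip: power_mult_distrib)
  then have "(\<lambda>x. x ^ n * (1 - x) ^ n) = poly (smult ((-1) ^ n) (endpoint_poly n))"
    by auto
  then have "poly_integral 0 1 (smult ((-1) ^ n) (endpoint_poly n)) = (fact n)\<^sup>2 / fact (2 * n + 1)"
    using integral_power_mult_power_complement [OF assms] by (simp only: poly_integral_def)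
  then have "(-1) ^ n * poly_integral 0 1 (endpoint_poly n) = (fact n)\<^sup>2 / fact (2 * n + 1)"
    by (simp only: poly_integral_smult)
  moreover have "poly_integral 0 1 (shifted_legendre n * shifted_legendre n) =
      fact (2 * n) * ((-1) ^ n * poly_integral 0 1 (endpoint_poly n))"
    by (simp add: poly_integral_shifted_legendre [OF assms] D poly_integral_smult)
  moreover have "fact (2 * n + 1) = (2 * real n + 1) * fact (2 * n)"
    by simp
  ultimately show ?thesis
    by simp
qed

text \<open>Partial integration on \<open>{0..a}\<close>: the boundary terms at 0 vanish, the kernel
  is annihilated by \<open>n\<close> derivatives, and at \<open>a\<close> one term survives. These
  are the Legendre coefficients of the truncated power up to normalization.\<close>

lemma trunc_kernel_shifted_legendre:
  assumes "r < n" "0 \<le> a" "a \<le> 1"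
  shows "poly_integral 0 a (shifted_legendre n * trunc_kernel r a) = poly ((pderiv ^^ (n - 1 - r)) (endpoint_poly n)) a"
  unfolding shifted_legendre_def
  using assms
  by (subst poly_integral_by_parts)
    (simp_all add: parts_boundary_eq_0 parts_boundary_trunc_kernel higher_pderiv_eq_0 degree_trunc_kernel)

text \<open>\<open>q\<close> is the \<open>L\<^sub>2\<close>-projection on \<open>{0..1}\<close> of \<open>(a - x)\<^sub>+\<^sup>r / r!\<close> to the polynomials of degree \<open>< n\<close>,
  and \<open>kernel_residual\<close> is its squared distance from them.\<close>
definition kernel_projection :: "nat \<Rightarrow> nat \<Rightarrow> real \<Rightarrow> real poly \<Rightarrow> bool" where
  "kernel_projection n r a q \<longleftrightarrow> degree q < n \<and>
     (\<forall>p. degree p < n \<longrightarrow> poly_integral 0 1 (q * p) = poly_integral 0 a (trunc_kernel r a * p))"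

definition kernel_residual :: "nat \<Rightarrow> real \<Rightarrow> real poly \<Rightarrow> real" where
  "kernel_residual r a q =
     poly_integral 0 a (trunc_kernel r a * trunc_kernel r a) - poly_integral 0 1 (q * q)"

text \<open>Admitting degree \<open>n\<close> adds the span of one Legendre polynomial, orthogonal
  to all lower degrees. The projection gains its Fourier term, and by Pythagoras the residual drops
  by \<open>D\<close> squared over the squared norm.\<close>

lemma kernel_projection_Suc:
  assumes q: "kernel_projection n r a q" and "r < n" "0 \<le> a" "a \<le> 1"
  defines "D \<equiv> poly ((pderiv ^^ (n - 1 - r)) (endpoint_poly n)) a"
  obtains q' where "kernel_projection (Suc n) r a q'"
    "kernel_residual r a q' = kernel_residual r a q - (2 * real n + 1) / (fact n)\<^sup>2 * D\<^sup>2"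
proof -
  let ?L = "shifted_legendre n"
  \<comment> \<open>The Fourier coefficient: \<open>D\<close> divided by the squared norm of the
    Legendre polynomial.\<close>
  define c where "c = (2 * real n + 1) / (fact n)\<^sup>2 * D"
  have LL: "poly_integral 0 1 (?L * ?L) = (fact n)\<^sup>2 / (2 * real n + 1)"
    using \<open>r < n\<close> by (intro shifted_legendre_norm) simp
  then have cLL: "c * poly_integral 0 1 (?L * ?L) = D"
  proof -
    have "2 * real n + 1 \<noteq> 0"
      by linarith
    then show ?thesis
      unfolding LL by (simp add: c_def)
  qed
  have TL: "poly_integral 0 a (trunc_kernel r a * ?L) = D"
    using assms trunc_kernel_shifted_legendre [of r n a] by (simp add: mult.commute)
  have qL: "poly_integral 0 1 (q * ?L) = 0"
    using q shifted_legendre_orthogonal [of q n] by (simp add: kernel_projection_def mult.commute)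
  define q' where "q' = q + smult c ?L"
  have "kernel_projection (Suc n) r a q'"
    unfolding kernel_projection_def
  proof (intro conjI allI impI)
    show "degree q' < Suc n"
      using q degree_add_le [of q n "smult c ?L"] degree_smult_le [of c ?L]
      by (simp add: q'_def kernel_projection_def degree_shifted_legendre)
    fix p :: "real poly" assume p: "degree p < Suc n"
    \<comment> \<open>Chosen to cancel the coefficient of degree \<open>n\<close>, so that the
      hypothesis on \<open>q\<close> applies to \<open>p'\<close>.\<close>
    define b where "b = coeff p n / coeff ?L n"
    define p' where "p' = p - smult b ?L"
    have "coeff ?L n \<noteq> 0"
      using degree_shifted_legendre [of n] \<open>r < n\<close> by (metis leading_coeff_0_iff degree_0 not_less_zero)
    then have "coeff p' n = 0"
      by (simp add: p'_def b_def)
    moreover have "degree p' \<le> n"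
      using p degree_diff_le [of p n "smult b ?L"] degree_smult_le [of b ?L]
      by (simp add: p'_def degree_shifted_legendre)
    \<comment> \<open>If \<open>p'\<close> is zero its degree is 0, which is below \<open>n\<close>
      because of \<open>r < n\<close>.\<close>
    ultimately have "degree p' < n"
      using \<open>r < n\<close> by (metis degree_0 leading_coeff_0_iff le_neq_implies_less gr_implies_not0 gr0I)
    then have "poly_integral 0 1 (q * p') = poly_integral 0 a (trunc_kernel r a * p')"
      "poly_integral 0 1 (?L * p') = 0"
      using q by (auto simp: kernel_projection_def shifted_legendre_orthogonal)
    moreover have "p = p' + smult b ?L"
      by (simp add: p'_def)
    ultimately show "poly_integral 0 1 (q' * p) = poly_integral 0 a (trunc_kernel r a * p)"
      using cLL by (simp add: q'_def poly_integral_add poly_integral_smult distrib_left distrib_right qL TL)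
  qed
  moreover have "kernel_residual r a q' = kernel_residual r a q - c * D"
  proof -
    have "poly_integral 0 1 (?L * q) = 0"
      using qL by (simp add: mult.commute)
    then show ?thesis
      using cLL by (simp add: kernel_residual_def q'_def poly_integral_add poly_integral_smult
          distrib_left distrib_right qL)
  qed
  ultimately show ?thesis
    by (intro that) (auto simp: c_def power2_eq_square)
qed

text \<open>By Pascal's rule each new term cancels the previous partial sum and leaves one binomial
  coefficient.\<close>

lemma alternating_choose_partial_sum:
  "(\<Sum>k\<le>r. (-1) ^ k * real (Suc n choose k)) = (-1) ^ r * real (n choose r)"
  by (induction r) (simp_all add: algebra_simps)

text \<open>The case \<open>k = 0\<close>. A spline with zeros of order \<open>m = r + 1\<close> at
  0 and 1 is glued from two polynomials at \<open>a\<close>. Its derivative of order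
  \<open>m\<close> is the truncated power minus \<open>q\<close> and is orthogonal to lower degrees,
  which identifies \<open>q\<close>; the residual is the value of the spline at
  \<open>a\<close>.\<close>

lemma kernel_projection_base:
  fixes a :: real
  assumes "0 \<le> a" "a \<le> 1"
  obtains q where "kernel_projection (Suc r) r a q"
    "kernel_residual r a q = (a * (1 - a)) ^ (2 * r + 1) / ((fact r)\<^sup>2 * (2 * real r + 1))"
proof -
  define m where "m = Suc r"
  define N where "N = 2 * r + 1"
  \<comment> \<open>This scaling makes the derivative of order \<open>m\<close> of
    \<open>u1 - u2\<close> exactly \<open>trunc_kernel r a\<close>.\<close>
  define c :: real where "c = (-1) ^ m / fact N"
  \<comment> \<open>The terms of the binomial expansion of
    \<open>(a * (1 - x) + (a - 1) * x) ^ N\<close>, whose base is \<open>a - x\<close>. For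
    \<open>k \<le> r\<close> they contain \<open>x ^ m\<close>, for \<open>k \<ge> m\<close> they
    contain \<open>(1 - x) ^ m\<close>.\<close>
  define B where "B k = smult (real (N choose k)) ([:a, -a:] ^ k * [:0, a - 1:] ^ (N - k))" for k
  \<comment> \<open>\<open>u1\<close> on \<open>{0..a}\<close> and \<open>u2\<close> on \<open>{a..1}\<close> form the extremal spline; \<open>u1 - u2\<close> is a power of \<open>a - x\<close>.\<close>
  define u1 where "u1 = smult c (\<Sum>k\<le>r. B k)"
  define u2 where "u2 = - smult c (\<Sum>k=m..N. B k)"
  have "{..N} = {..r} \<union> {m..N}"
    by (auto simp: m_def N_def)
  then have "(\<Sum>k\<le>N. B k) = (\<Sum>k\<le>r. B k) + (\<Sum>k=m..N. B k)"
    by (simp add: sum.union_disjoint m_def)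
  moreover have "(\<Sum>k\<le>N. B k) = [:a, -1:] ^ N"
    using binomial_ring [of "[:a, -a:]" "[:0, a - 1:]" N]
    by (simp add: B_def of_nat_poly mult.assoc)
  ultimately have diff: "u1 - u2 = smult ((-1) ^ m) (trunc_kernel N a)"
    by (simp add: u1_def u2_def trunc_kernel_def c_def flip: smult_add_right)
  have "[:- 0, 1:] ^ m dvd B k" if "k \<le> r" for k
  proof -
    have "[:0, a - 1:] = smult (a - 1) [:- 0, 1:]" by simp
    then have "[:- 0, 1:] ^ m dvd [:0, a - 1:] ^ m"
      by (metis dvd_smult dvd_refl smult_power)
    also have "\<dots> dvd [:0, a - 1:] ^ (N - k)"
      using that by (intro le_imp_power_dvd) (simp add: m_def N_def)
    finally show ?thesis
      by (auto simp: B_def intro!: dvd_smult dvd_mult)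
  qed
  then have "[:- 0, 1:] ^ m dvd u1"
    unfolding u1_def by (intro dvd_smult dvd_sum) auto
  then have u1_0: "poly ((pderiv ^^ j) u1) 0 = 0" if "j < m" for j
    using that by (rule poly_higher_pderiv_eq_0)
  have "[:- 1, 1:] ^ m dvd B k" if "k \<ge> m" for k
  proof -
    have "[:a, - a:] = smult (- a) [:- 1, 1:]" by simp
    then have "[:- 1, 1:] ^ m dvd [:a, - a:] ^ m"
      by (metis dvd_smult dvd_refl smult_power)
    also have "\<dots> dvd [:a, - a:] ^ k"
      using that by (intro le_imp_power_dvd)
    finally show ?thesis
      by (auto simp: B_def intro!: dvd_smult dvd_mult2)
  qed
  then have "[:- 1, 1:] ^ m dvd u2"
    unfolding u2_def by (intro dvd_minus_iff [THEN iffD2] dvd_smult dvd_sum) auto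
  then have u2_1: "poly ((pderiv ^^ j) u2) 1 = 0" if "j < m" for j
    using that by (rule poly_higher_pderiv_eq_0)
  have diff_deriv: "(pderiv ^^ j) u1 = (pderiv ^^ j) u2 + smult ((-1) ^ m * (-1) ^ j) (trunc_kernel (N - j) a)"
    if "j \<le> N" for j
  proof -
    have "u1 = u2 + smult ((-1) ^ m) (trunc_kernel N a)"
      using diff by (simp add: algebra_simps)
    then show ?thesis
      using that by (simp add: higher_pderiv_add higher_pderiv_smult higher_pderiv_trunc_kernel)
  qed
  \<comment> \<open>For \<open>j < m\<close> the exponent \<open>N - j\<close> is positive, so the
    kernel in \<open>diff_deriv\<close> vanishes at \<open>a\<close>.\<close>
  have u12_a: "poly ((pderiv ^^ j) u1) a = poly ((pderiv ^^ j) u2) a" if "j < m" for j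
    using diff_deriv [of j] that by (simp add: poly_trunc_kernel m_def N_def)
  have u12_m: "(pderiv ^^ m) u1 = (pderiv ^^ m) u2 + trunc_kernel r a"
  proof -
    have "(-1) ^ m * (-1) ^ m = (1::real)" "N - m = r" "m \<le> N"
      by (simp_all add: m_def N_def flip: power_add mult_2)
    then show ?thesis
      using diff_deriv [of m] by simp
  qed
  have "degree (B k) \<le> N" if "k \<le> N" for k
  proof -
    have "degree ([:a, -a:] ^ k) \<le> k" "degree ([:0, a - 1:] ^ (N - k)) \<le> N - k"
      using degree_power_le [of "[:a, -a:]" k] degree_power_le [of "[:0, a - 1:]" "N - k"]
      by (auto split: if_splits)
    then have "degree ([:a, -a:] ^ k * [:0, a - 1:] ^ (N - k)) \<le> N"
      using degree_mult_le [of "[:a, -a:] ^ k" "[:0, a - 1:] ^ (N - k)"] that by linarith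
    then show ?thesis
      unfolding B_def using degree_smult_le order_trans by blast
  qed
  then have "degree (\<Sum>k=m..N. B k) \<le> N"
    by (intro degree_sum_le) auto
  then have "degree u2 \<le> N"
    unfolding u2_def by (metis degree_minus degree_smult_le order_trans)
  \<comment> \<open>\<open>u2\<close> has degree at most \<open>N = 2 * m - 1\<close>, so
    \<open>m\<close> derivatives bring it below \<open>m\<close>.\<close>
  then have deg: "degree ((pderiv ^^ m) u2) < m"
    unfolding degree_higher_pderiv by (simp add: m_def N_def)
  define q where "q = - (pderiv ^^ m) u2"
  define b1 where "b1 = parts_boundary m (\<lambda>j. poly ((pderiv ^^ j) u1))"
  define b2 where "b2 = parts_boundary m (\<lambda>j. poly ((pderiv ^^ j) u2))"
  have by_parts1: "poly_integral 0 a ((pderiv ^^ m) u1 * p) = b1 p a" if "degree p < m" for p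
    using assms that poly_integral_by_parts [of 0 a m u1 p]
    by (simp add: b1_def u1_0 parts_boundary_eq_0 higher_pderiv_eq_0)
  have by_parts2: "poly_integral a 1 ((pderiv ^^ m) u2 * p) = - b2 p a" if "degree p < m" for p
    using assms that poly_integral_by_parts [of a 1 m u2 p]
    by (simp add: b2_def u2_1 parts_boundary_eq_0 higher_pderiv_eq_0)
  have b12: "b1 p a = b2 p a" for p
    unfolding b1_def b2_def parts_boundary_def by (intro sum.cong refl) (simp add: u12_a)
  \<comment> \<open>When the partial integrations on \<open>{0..a}\<close> and \<open>{a..1}\<close>
    are added, the boundary terms at \<open>a\<close> cancel because the two pieces match
    there.\<close>
  have orth: "poly_integral 0 1 (q * p) = poly_integral 0 a (trunc_kernel r a * p)" if "degree p < m" for p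
  proof -
    have "poly_integral 0 a ((pderiv ^^ m) u2 * p) + poly_integral 0 a (trunc_kernel r a * p) = b1 p a"
      using by_parts1 [OF that] by (simp add: u12_m poly_integral_add distrib_right)
    moreover have "poly_integral 0 1 ((pderiv ^^ m) u2 * p) =
        poly_integral 0 a ((pderiv ^^ m) u2 * p) + poly_integral a 1 ((pderiv ^^ m) u2 * p)"
      using assms by (intro poly_integral_split)
    ultimately show ?thesis
      using by_parts2 [OF that] b12 [of p] by (simp add: q_def poly_integral_minus)
  qed
  have degq: "degree q < m"
    using deg by (simp add: q_def)
  have proj: "kernel_projection (Suc r) r a q"
    using degq orth by (simp add: kernel_projection_def m_def)
  \<comment> \<open>Testing \<open>orth\<close> with \<open>q\<close> itself turns the residual into
    an integral of a derivative of \<open>u1\<close> against the kernel, which then evaluates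
    \<open>u1\<close> at \<open>a\<close>.\<close>
  have "kernel_residual r a q = poly_integral 0 a ((pderiv ^^ m) u1 * trunc_kernel r a)"
    using orth [OF degq] by (simp add: kernel_residual_def u12_m q_def poly_integral_add distrib_left
        poly_integral_minus mult.commute)
  also have "\<dots> = b1 (trunc_kernel r a) a"
    by (rule by_parts1) (simp add: degree_trunc_kernel m_def)
  also have "\<dots> = poly u1 a"
    unfolding b1_def by (subst parts_boundary_trunc_kernel) (simp_all add: m_def)
  also have "\<dots> = c * (\<Sum>k\<le>r. real (N choose k) * ((a * (1 - a)) ^ N * (-1) ^ (N - k)))"
  proof -
    have "poly (B k) a = real (N choose k) * ((a * (1 - a)) ^ N * (-1) ^ (N - k))" if "k \<le> r" for k
    proof -
      have "(a * (1 - a)) ^ N = (a * (1 - a)) ^ k * (a * (1 - a)) ^ (N - k)"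
        using that by (simp add: N_def flip: power_add)
      moreover have "poly [:a, -a:] a = a * (1 - a)" "poly [:0, a - 1:] a = (a * (1 - a)) * (-1)"
        by (simp_all add: algebra_simps)
      ultimately show ?thesis
        by (simp only: B_def poly_smult poly_mult poly_power power_mult_distrib [of _ "-1"])
    qed
    then show ?thesis
      by (simp add: u1_def poly_sum)
  qed
  also have "\<dots> = c * (a * (1 - a)) ^ N * - (\<Sum>k\<le>r. (-1) ^ k * real (Suc (2 * r) choose k))"
  proof -
    define P where "P = (a * (1 - a)) ^ N"
    \<comment> \<open>\<open>N\<close> is odd.\<close>
    have "(-1) ^ (N - k) = - ((-1) ^ k :: real)" if "k \<le> r" for k
      using that by (simp add: N_def uminus_power_if)
    then have "(\<Sum>k\<le>r. real (N choose k) * (P * (-1) ^ (N - k))) =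
        (\<Sum>k\<le>r. - P * ((-1) ^ k * real (Suc (2 * r) choose k)))"
      by (intro sum.cong) (simp_all add: N_def)
    also have "\<dots> = - P * (\<Sum>k\<le>r. (-1) ^ k * real (Suc (2 * r) choose k))"
      by (rule sum_distrib_left [symmetric])
    finally show ?thesis
      unfolding P_def [symmetric] by (simp only: mult_minus_left mult_minus_right mult.assoc)
  qed
  \<comment> \<open>The signs \<open>(-1) ^ (r + 1)\<close> from \<open>c\<close>,
    \<open>(-1) ^ r\<close> from the partial sum and the minus in front multiply to 1.\<close>
  also have "\<dots> = (a * (1 - a)) ^ N * (real ((2 * r) choose r) / fact N)"
    unfolding alternating_choose_partial_sum by (simp add: c_def m_def)
  also have "real ((2 * r) choose r) / fact N = 1 / ((fact r)\<^sup>2 * (2 * real r + 1))"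
  proof -
    have "real ((2 * r) choose r) = fact (2 * r) / (fact r)\<^sup>2"
      using binomial_fact [of r "2 * r", where 'a=real] by (simp add: power2_eq_square)
    moreover have "fact N = (2 * real r + 1) * fact (2 * r)"
      by (simp add: N_def)
    ultimately show ?thesis
      by simp
  qed
  finally show ?thesis
    using that [OF proj] by (simp add: N_def)
qed

subsection \<open>The embedding functional as a distance\<close>

text \<open>The component of the truncated power orthogonal to the polynomials. For
  \<open>r = 0\<close> it jumps at \<open>a\<close>, which is why \<open>a\<close> is treated as an
  exceptional point below.\<close>

definition residual_fun :: "nat \<Rightarrow> real \<Rightarrow> real poly \<Rightarrow> real \<Rightarrow> real" where
  "residual_fun r a q x = (if x < a then poly (trunc_kernel r a) x else 0) - poly q x"

lemma has_integral_truncate: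
  fixes f :: "real \<Rightarrow> real"
  assumes "(f has_integral i) {0..a}" "a \<le> 1"
  shows "((\<lambda>x. if x < a then f x else 0) has_integral i) {0..1}"
proof (rule has_integral_spike_finite [of "{a}"])
  show "((\<lambda>x. if x \<in> {0..a} then f x else 0) has_integral i) {0..1}"
    using assms by (subst has_integral_restrict) auto
qed auto

lemma has_integral_poly_integral: "(poly p has_integral poly_integral c d p) {c..d}"
  unfolding poly_integral_def by (intro integrable_integral poly_integrable)

lemma has_integral_residual_fun_poly:
  assumes "kernel_projection n r a q" "a \<le> 1" "degree p < n"
  shows "((\<lambda>x. residual_fun r a q x * poly p x) has_integral 0) {0..1}"
proof -
  have "((\<lambda>x. (if x < a then poly (trunc_kernel r a * p) x else 0) - poly (q * p) x) has_integral
      poly_integral 0 a (trunc_kernel r a * p) - poly_integral 0 1 (q * p)) {0..1}"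
    by (intro has_integral_diff has_integral_truncate has_integral_poly_integral assms)
  moreover have "(if x < a then poly (trunc_kernel r a * p) x else 0) - poly (q * p) x = residual_fun r a q x * poly p x" for x
    by (simp add: residual_fun_def algebra_simps)
  ultimately show ?thesis
    using assms by (simp add: kernel_projection_def)
qed

text \<open>Expand the square; testing the projection property with \<open>q\<close> itself turns
  the mixed integral into that of \<open>q * q\<close>.\<close>

lemma has_integral_residual_fun_square:
  assumes "kernel_projection n r a q" "a \<le> 1"
  shows "((\<lambda>x. (residual_fun r a q x)\<^sup>2) has_integral kernel_residual r a q) {0..1}"
proof -
  let ?k = "trunc_kernel r a"
  have "((\<lambda>x. (if x < a then poly (?k * ?k - smult 2 (?k * q)) x else 0) + poly (q * q) x) has_integral
      poly_integral 0 a (?k * ?k - smult 2 (?k * q)) + poly_integral 0 1 (q * q)) {0..1}"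
    by (intro has_integral_add has_integral_truncate has_integral_poly_integral assms)
  moreover have "(if x < a then poly (?k * ?k - smult 2 (?k * q)) x else 0) + poly (q * q) x = (residual_fun r a q x)\<^sup>2" for x
    by (simp add: residual_fun_def power2_eq_square algebra_simps)
  moreover have "poly_integral 0 1 (q * q) = poly_integral 0 a (?k * q)"
    using assms by (simp add: kernel_projection_def)
  ultimately show ?thesis
    by (simp add: kernel_residual_def poly_integral_diff poly_integral_smult)
qed

lemma kernel_residual_nonneg:
  assumes "kernel_projection n r a q" "a \<le> 1"
  shows "kernel_residual r a q \<ge> 0"
  using has_integral_residual_fun_square [OF assms] by (rule has_integral_nonneg) simp

text \<open>The kernel on \<open>{0..a}\<close> evaluates the derivative at \<open>a\<close>, while
  \<open>q\<close>, of degree below \<open>n\<close>, integrates to zero against \<open>u n\<close>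
  since all boundary values vanish. Subtracting \<open>q\<close> thus keeps the functional and
  minimizes the norm of its representer.\<close>

lemma deriv_chain_representation:
  assumes q: "kernel_projection n r a q" and "r < n" "0 \<le> a" "a \<le> 1" and u: "deriv_chain n u"
    and u0: "\<And>j. j < n \<Longrightarrow> u j 0 = 0" and u1: "\<And>j. j < n \<Longrightarrow> u j 1 = 0"
  shows "((\<lambda>x. u n x * residual_fun r a q x) has_integral u (n - 1 - r) a) {0..1}"
proof -
  have "((\<lambda>x. u n x * poly (trunc_kernel r a) x) has_integral u (n - 1 - r) a) {0..a}"
    using has_integral_by_parts_vanishing [OF u, of 0 a "trunc_kernel r a"] assms
    by (simp add: degree_trunc_kernel parts_boundary_trunc_kernel parts_boundary_eq_0)
  moreover have "((\<lambda>x. u n x * poly q x) has_integral 0) {0..1}"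
    using has_integral_by_parts_vanishing [OF u, of 0 1 q] assms
    by (simp add: kernel_projection_def parts_boundary_eq_0)
  ultimately have "((\<lambda>x. (if x < a then u n x * poly (trunc_kernel r a) x else 0) - u n x * poly q x) has_integral
      u (n - 1 - r) a - 0) {0..1}"
    using assms by (intro has_integral_diff has_integral_truncate)
  moreover have "(if x < a then u n x * poly (trunc_kernel r a) x else 0) - u n x * poly q x = u n x * residual_fun r a q x" for x
    by (simp add: residual_fun_def algebra_simps)
  ultimately show ?thesis
    by simp
qed

section \<open>Upper bound on the space\<close>

lemma W2_ring_deriv_chain:
  assumes f: "f \<in> W2_ring n" and "n \<ge> 1"
  shows "deriv_chain n (\<lambda>j. deriv01 j f)"
proof -
  have "(deriv01 j f has_vector_derivative deriv01 (Suc j) f x) (at x within {0..1})"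
    if "Suc j < n" "x \<in> {0..1}" for j x
    using f that by (auto simp: W2_ring_def differentiable_on_def vector_derivative_works)
  moreover have "\<exists>N. negligible N \<and>
        (\<forall>x\<in>{0..1} - N. (deriv01 (n - 1) f has_vector_derivative deriv01 n f x) (at x within {0..1}))"
  proof -
    have "AE x in lebesgue_on {0..1}. deriv01 (n - 1) f differentiable (at x within {0..1})"
      using f by (simp add: W2_ring_def)
    then have "AE x in lebesgue. x \<in> {0..1} \<longrightarrow> deriv01 (n - 1) f differentiable (at x within {0..1})"
      by (subst (asm) AE_restrict_space_iff) auto
    then obtain N where "negligible N"
      "{x. \<not> (x \<in> {0..1} \<longrightarrow> deriv01 (n - 1) f differentiable (at x within {0..1}))} \<subseteq> N"
      unfolding eventually_ae_filter_negligible by blast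
    moreover have "n = Suc (n - 1)"
      using \<open>n \<ge> 1\<close> by simp
    then have "deriv01 n f x = vector_derivative (deriv01 (n - 1) f) (at x within {0..1})" for x
      by (metis deriv01.simps(2))
    ultimately show ?thesis
      by (intro exI [of _ N]) (auto simp: vector_derivative_works)
  qed
  ultimately show ?thesis
    using f unfolding deriv_chain_def by (auto simp: W2_ring_def)
qed

lemma W2_ring_deriv_bound:
  assumes q: "kernel_projection n r a q" and "r < n" "0 \<le> a" "a \<le> 1" and f: "f \<in> W2_ring n"
    and le: "(LINT x|lebesgue_on {0..1}. \<bar>deriv01 n f x\<bar>\<^sup>2) \<le> 1"
  shows "\<bar>deriv01 (n - 1 - r) f a\<bar> \<le> sqrt (kernel_residual r a q)"
proof -
  define i where "i = deriv01 (n - 1 - r) f a"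
  define e where "e = (LINT x|lebesgue_on {0..1}. \<bar>deriv01 n f x\<bar>\<^sup>2)"
  define V where "V = kernel_residual r a q"
  let ?h = "residual_fun r a q"
  have "((\<lambda>x. deriv01 n f x * ?h x) has_integral i) {0..1}"
    unfolding i_def
    by (rule deriv_chain_representation [OF q assms(2-4) W2_ring_deriv_chain [OF f]])
      (use f \<open>r < n\<close> in \<open>auto simp: W2_ring_def\<close>)
  moreover have "((\<lambda>x. \<bar>deriv01 n f x\<bar>\<^sup>2) has_integral e) {0..1}"
    unfolding e_def using f by (intro has_integral_integral_lebesgue_on) (auto simp: W2_ring_def)
  moreover have "((\<lambda>x. (?h x)\<^sup>2) has_integral V) {0..1}"
    unfolding V_def by (rule has_integral_residual_fun_square [OF q \<open>a \<le> 1\<close>])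
  \<comment> \<open>Cauchy--Schwarz with the multiplier \<open>i\<close>, which needs no case distinction on \<open>V = 0\<close>\<close>
  ultimately have "((\<lambda>x. i\<^sup>2 * \<bar>deriv01 n f x\<bar>\<^sup>2 - 2 * i * (deriv01 n f x * ?h x) + (?h x)\<^sup>2) has_integral
      i\<^sup>2 * e - 2 * i * i + V) {0..1}"
    by (intro has_integral_add has_integral_diff has_integral_mult_right)
  then have "0 \<le> i\<^sup>2 * e - 2 * i * i + V"
  proof (rule has_integral_nonneg)
    fix x
    have "i\<^sup>2 * \<bar>deriv01 n f x\<bar>\<^sup>2 - 2 * i * (deriv01 n f x * ?h x) + (?h x)\<^sup>2 = (i * deriv01 n f x - ?h x)\<^sup>2"
      by (simp add: power2_eq_square algebra_simps)
    then show "0 \<le> i\<^sup>2 * \<bar>deriv01 n f x\<bar>\<^sup>2 - 2 * i * (deriv01 n f x * ?h x) + (?h x)\<^sup>2"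
      by simp
  qed
  moreover have "i\<^sup>2 * e \<le> i\<^sup>2"
    using mult_left_mono [OF le, of "i\<^sup>2"] by (simp add: e_def)
  ultimately have "i\<^sup>2 \<le> V"
    by (simp add: power2_eq_square)
  then show ?thesis
    by (simp add: i_def V_def real_le_rsqrt)
qed

section \<open>Iterated primitives and the extremal function\<close>

primrec iterated_integral :: "(real \<Rightarrow> real) \<Rightarrow> nat \<Rightarrow> real \<Rightarrow> real" where
  "iterated_integral h 0 = h"
| "iterated_integral h (Suc i) = (\<lambda>x. integral {0..x} (iterated_integral h i))"

lemma abs_continuous_integral:
  fixes h :: "real \<Rightarrow> real"
  assumes int: "h integrable_on {0..1}" and B: "\<And>x. x \<in> {0..1} \<Longrightarrow> \<bar>h x\<bar> \<le> B"
  shows "abs_continuous_on_interval 0 1 (\<lambda>x. integral {0..x} h)"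
proof (rule abs_continuous_on_interval_lipschitz)
  show "B \<ge> 0"
    using B [of 0] by auto
  fix x y :: real assume xy: "0 \<le> x" "x \<le> y" "y \<le> 1"
  have "h integrable_on {0..y}" "h integrable_on {x..y}"
    using int by (rule integrable_subinterval_real; use xy in auto)+
  then have "integral {0..y} h - integral {0..x} h = integral {x..y} h"
    using Henstock_Kurzweil_Integration.integral_combine [of 0 x y h] xy by simp
  moreover have "norm (integral {x..y} h) \<le> B * measure lborel (cbox x y)"
    by (rule has_integral_bound [of B h]) (use \<open>h integrable_on {x..y}\<close> B xy in \<open>auto simp: \<open>B \<ge> 0\<close>\<close>)
  ultimately show "\<bar>integral {0..y} h - integral {0..x} h\<bar> \<le> B * (y - x)"
    using xy by simp
qed

lemma abs_continuous_iterated_integral: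
  fixes h :: "real \<Rightarrow> real"
  assumes int: "h integrable_on {0..1}" and B: "\<And>x. x \<in> {0..1} \<Longrightarrow> \<bar>h x\<bar> \<le> B"
  shows "abs_continuous_on_interval 0 1 (iterated_integral h (Suc i))"
proof (induction i)
  case 0
  then show ?case
    using abs_continuous_integral [OF assms] by simp
next
  case (Suc i)
  let ?g = "iterated_integral h (Suc i)"
  have cont: "continuous_on {0..1} ?g"
    using Suc by (rule abs_continuous_on_interval_imp_continuous_on)
  obtain C where "\<And>x. x \<in> {0..1} \<Longrightarrow> \<bar>?g x\<bar> \<le> C"
    using continuous_on_interval_bounded [OF cont] by blast
  then have "abs_continuous_on_interval 0 1 (\<lambda>x. integral {0..x} ?g)"
    using cont by (intro abs_continuous_integral integrable_continuous_real) auto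
  then show ?case
    by simp
qed

text \<open>The index counts integrations, so the derivative of order \<open>j\<close> has index
  \<open>n - j\<close>. All primitives are continuous and have derivatives everywhere recovered from
  the integrand; only the last step, down to \<open>h\<close> itself, can fail, and only at
  \<open>a\<close>.\<close>

lemma deriv_chain_iterated_integral:
  fixes h :: "real \<Rightarrow> real"
  assumes int: "h integrable_on {0..1}" and B: "\<And>x. x \<in> {0..1} \<Longrightarrow> \<bar>h x\<bar> \<le> B"
    and cont: "\<And>x. x \<noteq> a \<Longrightarrow> isCont h x" and "n \<ge> 1"
  shows "deriv_chain n (\<lambda>j. iterated_integral h (n - j))"
  unfolding deriv_chain_def
proof (intro conjI allI impI ballI)
  fix j x assume "Suc j < n" and x: "x \<in> {0..1::real}"
  then obtain l where l: "n - j = Suc (Suc l)" "n - Suc j = Suc l"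
    by (metis Suc_diff_Suc Suc_lessD)
  have "continuous_on {0..1} (iterated_integral h (Suc l))"
    using abs_continuous_iterated_integral [OF int B] by (rule abs_continuous_on_interval_imp_continuous_on)
  then show "(iterated_integral h (n - j) has_vector_derivative iterated_integral h (n - Suc j) x) (at x within {0..1})"
    unfolding l iterated_integral.simps(2) [of h "Suc l"] using x by (rule integral_has_vector_derivative)
next
  fix j assume "j < n"
  then have "n - j = Suc (n - Suc j)" by simp
  then show "abs_continuous_on_interval 0 1 (iterated_integral h (n - j))"
    using abs_continuous_iterated_integral [OF int B] by metis
next
  show "\<exists>N. negligible N \<and> (\<forall>x\<in>{0..1} - N.
      (iterated_integral h (n - (n - 1)) has_vector_derivative iterated_integral h (n - n) x) (at x within {0..1}))"
  proof (intro exI [of _ "{a}"] conjI ballI)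
    fix x assume x: "x \<in> {0..1} - {a}"
    have "((\<lambda>u. integral {0..u} h) has_vector_derivative h x) (at x within ({0..1} - {}))"
      using int x cont by (intro integral_has_vector_derivative_continuous_at) (auto intro: continuous_at_imp_continuous_at_within)
    then show "(iterated_integral h (n - (n - 1)) has_vector_derivative iterated_integral h (n - n) x) (at x within {0..1})"
      using \<open>n \<ge> 1\<close> by simp
  qed simp
qed

lemma residual_fun_isCont:
  assumes "x \<noteq> a"
  shows "isCont (residual_fun r a q) x"
proof (cases "x < a")
  case True
  have "continuous_on {..<a} (residual_fun r a q)"
    by (rule continuous_on_eq [of _ "\<lambda>x. poly (trunc_kernel r a) x - poly q x"])
      (auto intro!: continuous_intros simp: residual_fun_def)
  then show ?thesis
    using True by (simp add: continuous_on_eq_continuous_at)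
next
  case False
  have "continuous_on {a<..} (residual_fun r a q)"
    by (rule continuous_on_eq [of _ "\<lambda>x. - poly q x"])
      (auto intro!: continuous_intros simp: residual_fun_def)
  then show ?thesis
    using False assms by (simp add: continuous_on_eq_continuous_at)
qed

lemma residual_fun_bounded:
  obtains B where "\<And>x. x \<in> {0..1} \<Longrightarrow> \<bar>residual_fun r a q x\<bar> \<le> B"
proof -
  obtain C where C: "C \<ge> 0" "\<And>x. x \<in> {0..1} \<Longrightarrow> \<bar>poly (trunc_kernel r a) x\<bar> \<le> C"
    using continuous_on_interval_bounded [OF continuous_on_poly [OF continuous_on_id], of 0 1 "trunc_kernel r a"] by blast
  obtain D where D: "D \<ge> 0" "\<And>x. x \<in> {0..1} \<Longrightarrow> \<bar>poly q x\<bar> \<le> D"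
    using continuous_on_interval_bounded [OF continuous_on_poly [OF continuous_on_id], of 0 1 q] by blast
  show ?thesis
  proof (rule that)
    fix x :: real assume "x \<in> {0..1}"
    then show "\<bar>residual_fun r a q x\<bar> \<le> C + D"
      using C(1) C(2) [of x] D(2) [of x] unfolding residual_fun_def by (auto split: if_splits)
  qed
qed

lemma residual_fun_borel: "residual_fun r a q \<in> borel_measurable borel"
proof -
  have "poly p \<in> borel_measurable borel" for p :: "real poly"
    by (intro borel_measurable_continuous_onI continuous_intros)
  then show ?thesis
    unfolding residual_fun_def [abs_def] by measurable
qed

text \<open>Equality in Cauchy-Schwarz asks for a derivative of order \<open>n\<close> proportional
  to the residual. Its \<open>n\<close>-fold primitive from 0 satisfies the conditions at 1 exactly
  because the residual is orthogonal to all polynomials of degree below \<open>n\<close>.\<close>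

lemma W2_ring_extremal:
  assumes q: "kernel_projection n r a q" and "r < n" "0 \<le> a" "a \<le> 1"
  obtains f where "f \<in> W2_ring n" "(LINT x|lebesgue_on {0..1}. \<bar>deriv01 n f x\<bar>\<^sup>2) \<le> 1"
    "\<bar>deriv01 (n - 1 - r) f a\<bar> = sqrt (kernel_residual r a q)"
proof -
  define h where "h = residual_fun r a q"
  define V where "V = kernel_residual r a q"
  define C where "C = 1 / sqrt V" \<comment> \<open>\<open>C = 0\<close> if \<open>V = 0\<close>, and then the extremal is \<open>0\<close>\<close>
  define f where "f x = C * iterated_integral h n x" for x
  have "V \<ge> 0"
    unfolding V_def by (rule kernel_residual_nonneg [OF q \<open>a \<le> 1\<close>])
  have int: "h integrable_on {0..1}"
    unfolding h_def residual_fun_def [abs_def]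
    by (intro integrable_diff poly_integrable assms
        has_integral_integrable [OF has_integral_truncate [OF has_integral_poly_integral]])
  obtain B where B: "\<And>x. x \<in> {0..1} \<Longrightarrow> \<bar>h x\<bar> \<le> B"
    unfolding h_def by (rule residual_fun_bounded) blast
  have cont: "isCont h x" if "x \<noteq> a" for x
    unfolding h_def using that by (rule residual_fun_isCont)
  have chain: "deriv_chain l (\<lambda>j. iterated_integral h (l - j))" if "l \<ge> 1" for l
    using deriv_chain_iterated_integral [OF int B cont that] .
  have u0: "iterated_integral h i 0 = 0" if "i \<ge> 1" for i
    using that by (cases i) auto
  \<comment> \<open>Taylor's formula at 1: the value is the integral of \<open>h\<close> against
    \<open>(1 - x) ^ (i - 1) / fact (i - 1)\<close>, a polynomial of degree below
    \<open>n\<close>.\<close>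
  have u1: "iterated_integral h i 1 = 0" if i: "1 \<le> i" "i \<le> n" for i
  proof -
    let ?k = "trunc_kernel (i - 1) 1"
    have "((\<lambda>x. iterated_integral h (i - i) x * poly ?k x) has_integral iterated_integral h (i - (i - 1 - (i - 1))) 1 - 0) {0..1}"
      using has_integral_by_parts_vanishing [OF chain [OF i(1)], of 0 1 ?k] i
      by (simp add: degree_trunc_kernel parts_boundary_trunc_kernel parts_boundary_eq_0 u0)
    moreover have "((\<lambda>x. h x * poly ?k x) has_integral 0) {0..1}"
      unfolding h_def
      by (rule has_integral_residual_fun_poly [OF q \<open>a \<le> 1\<close>]) (use i in \<open>simp add: degree_trunc_kernel\<close>)
    ultimately show ?thesis
      by (simp add: has_integral_unique)
  qed
  have "n \<ge> 1"
    using \<open>r < n\<close> by simp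
  note ch = chain [OF this, unfolded deriv_chain_def]
  have vd: "((\<lambda>y. C * g y) has_vector_derivative C * g') (at x within {0..1})"
    if "(g has_vector_derivative g') (at x within {0..1})" for g g' and x :: real
    using that by (rule has_vector_derivative_mult_right)
  have df: "deriv01 j f x = C * iterated_integral h (n - j) x" if "j < n" "x \<in> {0..1}" for j x
    using that
  proof (induction j arbitrary: x)
    case 0
    then show ?case by (simp add: f_def)
  next
    case (Suc j)
    have "(iterated_integral h (n - j) has_vector_derivative iterated_integral h (n - Suc j) x) (at x within {0..1})"
      using ch Suc.prems by blast
    then have "((\<lambda>y. C * iterated_integral h (n - j) y) has_vector_derivative C * iterated_integral h (n - Suc j) x) (at x within {0..1})"
      by (rule vd)
    then have "(deriv01 j f has_vector_derivative C * iterated_integral h (n - Suc j) x) (at x within {0..1})"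
      by (rule has_vector_derivative_transform [rotated 2]) (use Suc in auto)
    then show ?case
      using Suc.prems by (simp add: vector_derivative_within_closed_interval)
  qed
  have der: "(deriv01 j f has_vector_derivative C * iterated_integral h (n - Suc j) x) (at x within {0..1})"
    if "j < n" "x \<in> {0..1}" "Suc j < n \<or> x \<noteq> a" for j x
  proof -
    have "(iterated_integral h (n - j) has_vector_derivative iterated_integral h (n - Suc j) x) (at x within {0..1})"
    proof (cases "Suc j < n")
      case True
      then show ?thesis
        using ch that by blast
    next
      case False
      then have "n = Suc j" "x \<noteq> a"
        using that by auto
      moreover have "((\<lambda>u. integral {0..u} h) has_vector_derivative h x) (at x within ({0..1} - {}))"
        using int that cont \<open>x \<noteq> a\<close>
        by (intro integral_has_vector_derivative_continuous_at) (auto intro: continuous_at_imp_continuous_at_within)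
      ultimately show ?thesis
        by simp
    qed
    then have "((\<lambda>y. C * iterated_integral h (n - j) y) has_vector_derivative C * iterated_integral h (n - Suc j) x) (at x within {0..1})"
      by (rule vd)
    then show ?thesis
      by (rule has_vector_derivative_transform [rotated 2]) (use df that in auto)
  qed
  have dfn: "deriv01 n f x = C * h x" if "x \<in> {0..1} - {a}" for x
  proof -
    have "Suc (n - 1) = n"
      using \<open>n \<ge> 1\<close> by simp
    then have "deriv01 n f x = vector_derivative (deriv01 (n - 1) f) (at x within {0..1})"
      by (metis deriv01.simps(2))
    also have "\<dots> = C * h x"
      using der [of "n - 1" x] that \<open>n \<ge> 1\<close> by (simp add: vector_derivative_within_closed_interval)
    finally show ?thesis .
  qed
  have meas: "deriv01 n f \<in> borel_measurable (lebesgue_on {0..1})"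
  proof -
    have h: "h \<in> borel_measurable (lebesgue_on {0..1})"
      unfolding h_def using residual_fun_borel by (simp add: measurable_completion measurable_restrict_space1)
    \<comment> \<open>\<open>deriv01 n f a\<close> may be an unspecified value, so it is carried
      along as a constant on the single point \<open>a\<close>.\<close>
    have "(\<lambda>x. if x = a then deriv01 n f a else C * h x) \<in> borel_measurable (lebesgue_on {0..1})"
    proof (intro measurable_If)
      show "{x \<in> space (lebesgue_on {0..1}). x = a} \<in> sets (lebesgue_on {0..1})"
      proof -
        have "{x \<in> space (lebesgue_on {0..1}). x = a} = {a} \<inter> {0..1}"
          by auto
        then show ?thesis
          by (simp add: sets_restrict_space_iff)
      qed
    qed (use h in auto)
    then show ?thesis
      by (rule measurable_cong [THEN iffD1, rotated]) (use dfn in auto)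
  qed
  have sq: "((\<lambda>x. \<bar>deriv01 n f x\<bar>\<^sup>2) has_integral C\<^sup>2 * V) {0..1}"
  proof (rule has_integral_spike_finite [of "{a}"])
    show "((\<lambda>x. C\<^sup>2 * (h x)\<^sup>2) has_integral C\<^sup>2 * V) {0..1}"
      unfolding h_def V_def by (intro has_integral_mult_right has_integral_residual_fun_square [OF q \<open>a \<le> 1\<close>])
  qed (use dfn in \<open>auto simp: power_mult_distrib\<close>)
  have sqint: "integrable (lebesgue_on {0..1}) (\<lambda>x. \<bar>deriv01 n f x\<bar>\<^sup>2)"
  proof -
    have "(\<lambda>x. \<bar>deriv01 n f x\<bar>\<^sup>2) absolutely_integrable_on {0..1}"
      using sq by (intro nonnegative_absolutely_integrable_1) auto
    then show ?thesis
      by (simp add: integrable_restrict_space set_integrable_def)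
  qed
  have "C\<^sup>2 * V \<le> 1"
    using \<open>V \<ge> 0\<close> by (simp add: C_def power_divide)
  then have le1: "(LINT x|lebesgue_on {0..1}. \<bar>deriv01 n f x\<bar>\<^sup>2) \<le> 1"
    using sq sqint by (simp add: lebesgue_integral_eq_integral integral_unique)
  have W: "f \<in> W2_ring n"
    unfolding W2_ring_def
  proof (intro CollectI conjI allI impI)
    show "deriv01 j f differentiable_on {0..1}" if "Suc j < n" for j
      unfolding differentiable_on_def
    proof
      fix x :: real assume "x \<in> {0..1}"
      then show "deriv01 j f differentiable at x within {0..1}"
        using that by (intro differentiableI_vector [OF der]) auto
    qed
    show "abs_continuous_on_interval 0 1 (deriv01 j f)" if "j < n" for j
    proof (rule abs_continuous_on_interval_dominated [where C = "\<bar>C\<bar>" and L = 0])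
      show "abs_continuous_on_interval 0 1 (iterated_integral h (n - j))"
        using ch that by blast
    qed (use that in \<open>auto simp: df simp flip: abs_mult right_diff_distrib\<close>)
    show "AE x in lebesgue_on {0..1}. deriv01 (n - 1) f differentiable at x within {0..1}"
    proof -
      have "deriv01 (n - 1) f differentiable at x within {0..1}" if "x \<in> {0..1}" "x \<noteq> a" for x
        using that \<open>n \<ge> 1\<close> by (intro differentiableI_vector [OF der]) auto
      then have "\<exists>N. negligible N \<and> {x. \<not> (x \<in> {0..1} \<longrightarrow> deriv01 (n - 1) f differentiable at x within {0..1})} \<subseteq> N"
        by (intro exI [of _ "{a}"]) auto
      then show ?thesis
        by (subst AE_restrict_space_iff) (auto simp: eventually_ae_filter_negligible)
    qed
    show "deriv01 j f 0 = 0" "deriv01 j f 1 = 0" if "j < n" for j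
      using that by (auto simp: df u0 u1)
  qed (fact meas sqint)+
  have "((\<lambda>x. deriv01 n f x * h x) has_integral deriv01 (n - 1 - r) f a) {0..1}"
    unfolding h_def
    by (rule deriv_chain_representation [OF q assms(2-4) W2_ring_deriv_chain [OF W \<open>n \<ge> 1\<close>]])
      (use W in \<open>auto simp: W2_ring_def\<close>)
  moreover have "((\<lambda>x. deriv01 n f x * h x) has_integral C * V) {0..1}"
  proof (rule has_integral_spike_finite [of "{a}"])
    show "((\<lambda>x. C * (h x)\<^sup>2) has_integral C * V) {0..1}"
      unfolding h_def V_def by (intro has_integral_mult_right has_integral_residual_fun_square [OF q \<open>a \<le> 1\<close>])
  qed (use dfn in \<open>auto simp: power2_eq_square\<close>)
  ultimately have "deriv01 (n - 1 - r) f a = C * V"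
    by (rule has_integral_unique)
  also have "\<dots> = sqrt V"
    using \<open>V \<ge> 0\<close> by (simp add: C_def real_div_sqrt)
  finally show ?thesis
    using that [OF W le1] \<open>V \<ge> 0\<close> by (simp add: V_def)
qed

lemma A_emb_eq_sqrt_kernel_residual:
  assumes "kernel_projection n r a q" "r < n" "0 \<le> a" "a \<le> 1"
  shows "A_emb n (n - 1 - r) a = sqrt (kernel_residual r a q)"
proof -
  obtain f where "f \<in> W2_ring n" "(LINT x|lebesgue_on {0..1}. \<bar>deriv01 n f x\<bar>\<^sup>2) \<le> 1"
    "\<bar>deriv01 (n - 1 - r) f a\<bar> = sqrt (kernel_residual r a q)"
    using W2_ring_extremal [OF assms] .
  then show ?thesis
    unfolding A_emb_def using W2_ring_deriv_bound [OF assms]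
    by (intro cSup_eq_maximum) (auto simp: image_iff)
qed

subsection \<open>Maximization of the explicit formula\<close>

text \<open>Mean value theorem: the derivative of \<open>artanh\<close> is at least 1 on the
  interval.\<close>

lemma artanh_ge_self:
  fixes x :: real
  assumes "0 \<le> x" "x < 1"
  shows "x \<le> artanh x"
proof (cases "x = 0")
  case False
  have "\<exists>z. 0 < z \<and> z < x \<and> artanh x - artanh 0 = (x - 0) * (1 / (1 - z\<^sup>2))"
    using assms False by (intro MVT2) (auto intro!: artanh_real_has_field_derivative)
  then obtain z where z: "0 < z" "z < x" "artanh x = x * (1 / (1 - z\<^sup>2))"
    by auto
  then have "1 \<le> 1 / (1 - z\<^sup>2)"
    using assms by (simp add: le_divide_eq power_less_one_iff)
  then have "x * 1 \<le> x * (1 / (1 - z\<^sup>2))"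
    using assms by (intro mult_left_mono)
  then show ?thesis
    using z by simp
qed simp

text \<open>Mean value theorem again: the derivative at the intermediate point is at most its value
  at \<open>x\<close>.\<close>

lemma artanh_le:
  fixes x :: real
  assumes "0 \<le> x" "x < 1"
  shows "artanh x \<le> x / (1 - x\<^sup>2)"
proof (cases "x = 0")
  case False
  have "\<exists>z. 0 < z \<and> z < x \<and> artanh x - artanh 0 = (x - 0) * (1 / (1 - z\<^sup>2))"
    using assms False by (intro MVT2) (auto intro!: artanh_real_has_field_derivative)
  then obtain z where z: "0 < z" "z < x" "artanh x = x * (1 / (1 - z\<^sup>2))"
    by auto
  have "0 < 1 - x\<^sup>2"
    using assms by (auto simp: power_less_one_iff)
  moreover have "z\<^sup>2 \<le> x\<^sup>2"
    using z by (intro power_mono) auto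
  ultimately have "1 / (1 - z\<^sup>2) \<le> 1 / (1 - x\<^sup>2)"
    by (intro divide_left_mono mult_pos_pos) auto
  then show ?thesis
    using z assms mult_left_mono [of "1 / (1 - z\<^sup>2)" "1 / (1 - x\<^sup>2)" x] by simp
qed simp

text \<open>What remains of the square of \<open>A_emb (m + 3) 3 a\<close>, with
  \<open>x = m\<close> and \<open>s = a * (1 - a)\<close>, after removing
  \<open>s ^ (2 * m - 1) / (fact m)\<^sup>2\<close>. A real \<open>x\<close> keeps the algebra free
  of casts.\<close>

definition profile_factor :: "real \<Rightarrow> real \<Rightarrow> real" where
  "profile_factor x s = x\<^sup>2 / (2 * x - 1) - 3 * (2 * x + 3) * s
     + 12 * (2 * x + 3) * (x + 2) / (x + 1) * s\<^sup>2 - 4 * (2 * x + 5) * (2 * x + 3)\<^sup>2 / (x + 1)\<^sup>2 * s ^ 3"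

definition profile :: "nat \<Rightarrow> real \<Rightarrow> real" where
  "profile m s = s ^ (2 * m - 1) * profile_factor m s / (fact m)\<^sup>2"

text \<open>The quadratic factor of the derivative of \<open>profile\<close>; its roots are the two
  candidates for the maximum.\<close>

definition critical_quadratic :: "real \<Rightarrow> real \<Rightarrow> real" where
  "critical_quadratic x s = 4 * (2 * x + 5) * (2 * x + 3) * s\<^sup>2 - 4 * (x + 1) * (2 * x + 3) * s + x * (x + 1)"

text \<open>After taking out the power of \<open>s\<close>, a cubic is left. That it splits into
  \<open>critical_quadratic\<close> and a linear factor is checked by expansion once the
  denominators are cleared.\<close>

lemma profile_has_derivative:
  assumes "m \<ge> 1"
  shows "(profile m has_real_derivative
    s ^ (2 * m - 2) * (critical_quadratic m s * (m - 2 * (2 * m + 3) * s)) / ((real m + 1) * (fact m)\<^sup>2)) (at s)"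
proof -
  define x where "x = real m"
  define c0 where "c0 = x\<^sup>2 / (2 * x - 1)"
  define c1 where "c1 = 3 * (2 * x + 3)"
  define c2 where "c2 = 12 * (2 * x + 3) * (x + 2) / (x + 1)"
  define c3 where "c3 = 4 * (2 * x + 5) * (2 * x + 3)\<^sup>2 / (x + 1)\<^sup>2"
  have "x \<ge> 1"
    using assms by (simp add: x_def)
  obtain k where k: "m = Suc k"
    using assms by (cases m) auto
  have pf: "profile m = (\<lambda>s. s ^ (2 * k + 1) * (c0 - c1 * s + c2 * s\<^sup>2 - c3 * s ^ 3) / (fact m)\<^sup>2)"
    by (auto simp: profile_def profile_factor_def c0_def c1_def c2_def c3_def x_def k)
  have "((\<lambda>s. s ^ (2 * k + 1) * (c0 - c1 * s + c2 * s\<^sup>2 - c3 * s ^ 3)) has_real_derivative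
      s ^ (2 * k) * ((2 * x - 1) * (c0 - c1 * s + c2 * s\<^sup>2 - c3 * s ^ 3) + s * (- c1 + 2 * c2 * s - 3 * c3 * s\<^sup>2))) (at s)"
    by (rule derivative_eq_intros refl)+ (simp add: x_def k algebra_simps power2_eq_square)
  then have "((\<lambda>s. s ^ (2 * k + 1) * (c0 - c1 * s + c2 * s\<^sup>2 - c3 * s ^ 3) / (fact m)\<^sup>2) has_real_derivative
      s ^ (2 * k) * ((2 * x - 1) * (c0 - c1 * s + c2 * s\<^sup>2 - c3 * s ^ 3) + s * (- c1 + 2 * c2 * s - 3 * c3 * s\<^sup>2)) / (fact m)\<^sup>2) (at s)"
    by (rule DERIV_cdivide)
  moreover have "(2 * x - 1) * (c0 - c1 * s + c2 * s\<^sup>2 - c3 * s ^ 3) + s * (- c1 + 2 * c2 * s - 3 * c3 * s\<^sup>2)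
      = critical_quadratic x s * (x - 2 * (2 * x + 3) * s) / (x + 1)"
  proof -
    have *: "(2 * x - 1) * c0 = x\<^sup>2" "(x + 1) * c2 = 12 * (2 * x + 3) * (x + 2)"
      "(x + 1) * c3 * (x + 1) = 4 * (2 * x + 5) * (2 * x + 3)\<^sup>2"
      using \<open>x \<ge> 1\<close> by (auto simp: c0_def c2_def c3_def power2_eq_square)
    have "(x + 1) * ((2 * x - 1) * (c0 - c1 * s + c2 * s\<^sup>2 - c3 * s ^ 3) + s * (- c1 + 2 * c2 * s - 3 * c3 * s\<^sup>2))
      = (x + 1) * ((2 * x - 1) * c0) - (x + 1) * 2 * x * c1 * s + (2 * x + 1) * ((x + 1) * c2) * s\<^sup>2
        - 2 * ((x + 1) * c3 * (x + 1)) * s ^ 3"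
      by (simp add: algebra_simps power2_eq_square power3_eq_cube)
    also have "\<dots> = critical_quadratic x s * (x - 2 * (2 * x + 3) * s)"
      unfolding * c1_def critical_quadratic_def by (simp add: algebra_simps power2_eq_square power3_eq_cube)
    finally show ?thesis
      using \<open>x \<ge> 1\<close> by (simp add: eq_divide_eq mult.commute)
  qed
  moreover have "2 * m - 2 = 2 * k"
    by (simp add: k)
  ultimately show ?thesis
    unfolding pf by (simp add: x_def add_ac)
qed

text \<open>Vieta's relations: the sum of the roots is immediate, and their product rests on the
  identity \<open>b2\<close>.\<close>

lemma critical_quadratic_factor:
  assumes "x \<ge> 1" "\<rho>\<^sup>2 = 3 * (x + 1) * (2 * x + 3)"
  shows "critical_quadratic x s = 4 * (2 * x + 5) * (2 * x + 3) *
      (s - ((x + 1) * (2 * x + 3) - \<rho>) / (2 * (2 * x + 5) * (2 * x + 3))) *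
      (s - ((x + 1) * (2 * x + 3) + \<rho>) / (2 * (2 * x + 5) * (2 * x + 3)))"
proof -
  define d where "d = 2 * (2 * x + 5) * (2 * x + 3)"
  define b where "b = (x + 1) * (2 * x + 3)"
  have "d \<noteq> 0"
    using assms by (simp add: d_def)
  have b2: "b\<^sup>2 - \<rho>\<^sup>2 = d * (x * (x + 1)) / 2"
    unfolding assms(2) b_def d_def by (simp add: algebra_simps power2_eq_square)
  have "2 * d * (s - (b - \<rho>) / d) * (s - (b + \<rho>) / d) = 2 * d * s\<^sup>2 - 4 * b * s + 2 * (b\<^sup>2 - \<rho>\<^sup>2) / d"
    using \<open>d \<noteq> 0\<close> by (simp add: divide_simps) (simp add: algebra_simps power2_eq_square)
  also have "\<dots> = critical_quadratic x s"
  proof -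
    have "2 * (d * (x * (x + 1)) / 2) / d = x * (x + 1)"
      using \<open>d \<noteq> 0\<close> by simp
    then show ?thesis
      unfolding b2 by (simp only:) (simp add: critical_quadratic_def d_def b_def algebra_simps)
  qed
  finally have "2 * d * (s - (b - \<rho>) / d) * (s - (b + \<rho>) / d) = critical_quadratic x s" .
  moreover have "4 * (2 * x + 5) * (2 * x + 3) = 2 * d"
    by (simp add: d_def)
  ultimately show ?thesis
    by (simp only: d_def [symmetric] b_def [symmetric])
qed

text \<open>Division of the cubic by \<open>critical_quadratic\<close>: at a root only the linear
  remainder is left to evaluate.\<close>

lemma profile_factor_remainder:
  assumes "x \<ge> 1"
  shows "profile_factor x s = 3 * x / ((2 * x - 1) * (2 * x + 5)) - 3 * (2 * x + 3) * s / ((x + 1) * (2 * x + 5))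
    + critical_quadratic x s * ((x + 3) / ((x + 1) * (2 * x + 5)) - (2 * x + 3) * s / (x + 1)\<^sup>2)"
proof -
  have "x + 1 \<noteq> 0" "2 * x - 1 \<noteq> 0" "2 * x + 5 \<noteq> 0"
    using assms by auto
  then show ?thesis
    unfolding profile_factor_def critical_quadratic_def
    by (simp add: divide_simps) (simp add: algebra_simps power2_eq_square power3_eq_cube)
qed

text \<open>Only the square of \<open>\<rho>\<close> is prescribed, so both signs are covered: the
  positive root gives the value at the larger critical point, the negative one at the
  smaller.\<close>

lemma profile_critical_value:
  assumes "m \<ge> 1" and \<rho>: "\<rho>\<^sup>2 = 3 * (real m + 1) * (2 * real m + 3)"
    and s: "s = ((real m + 1) * (2 * real m + 3) + \<rho>) / (2 * (2 * real m + 5) * (2 * real m + 3))"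
  shows "profile m s = (2 * s) ^ (2 * m - 1) *
    (3 * (real m + 1) * (3 * (real m + 1) * (2 * real m + 1) - (2 * real m - 1) * \<rho>)
       / (4 ^ m * (fact (m + 1))\<^sup>2 * (2 * real m + 5)\<^sup>2 * (2 * real m - 1)))"
proof -
  define x where "x = real m"
  define p where "p = 2 * x - 1"
  define y where "y = x + 1"
  define z where "z = 2 * x + 5"
  have "x \<ge> 1"
    using assms by (simp add: x_def)
  then have nz: "y \<noteq> 0" "p \<noteq> 0" "z \<noteq> 0" "2 * x + 3 \<noteq> 0"
    by (auto simp: y_def p_def z_def)
  have "critical_quadratic x s = 0"
    using critical_quadratic_factor [OF \<open>x \<ge> 1\<close>, of \<rho> s] \<rho> s by (simp add: x_def)
  then have "profile_factor x s = 3 * x / (p * z) - 3 * ((2 * x + 3) * s) / (y * z)"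
    using profile_factor_remainder [OF \<open>x \<ge> 1\<close>, of s] by (simp add: p_def y_def z_def)
  also have "(2 * x + 3) * s = (y * (2 * x + 3) + \<rho>) / (2 * z)"
  proof -
    define k where "k = 2 * x + 3"
    have "s = (y * k + \<rho>) / (2 * z * k)"
      by (simp add: s x_def y_def z_def k_def)
    moreover have "k \<noteq> 0"
      using nz by (simp add: k_def)
    ultimately show ?thesis
      unfolding k_def [symmetric] by simp
  qed
  also have "3 * x / (p * z) - 3 * ((y * (2 * x + 3) + \<rho>) / (2 * z)) / (y * z)
      = 3 * (2 * z * x * y - p * (y * (2 * x + 3) + \<rho>)) / (2 * p * z\<^sup>2 * y)"
    using nz by (simp add: divide_simps) (simp add: algebra_simps power2_eq_square)
  also have "2 * z * x * y - p * (y * (2 * x + 3) + \<rho>) = 3 * y * (2 * x + 1) - p * \<rho>"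
    by (simp add: z_def p_def algebra_simps)
  finally have G: "profile_factor x s = 3 * (3 * y * (2 * x + 1) - p * \<rho>) / (2 * p * z\<^sup>2 * y)" .
  \<comment> \<open>Converts the power of \<open>s\<close> into a power of \<open>2 * s\<close>, the
    base in the final formula.\<close>
  have "2 * 2 ^ (2 * m - 1) = (2::real) ^ (2 * m)"
    using assms by (simp flip: power_Suc)
  then have two: "(2::real) ^ (2 * m - 1) = 4 ^ m / 2"
    by (simp add: power_mult)
  have power: "(2 * s) ^ (2 * m - 1) = 4 ^ m / 2 * s ^ (2 * m - 1)"
    by (simp only: power_mult_distrib two)
  have fact: "fact (m + 1) = y * fact m"
    by (simp add: y_def x_def)
  \<comment> \<open>Large subterms become plain variables, so that clearing fractions does not
    expand them.\<close>
  have cancel: "P / 2 * S * (3 * y * W / (P * (y * F)\<^sup>2 * z\<^sup>2 * p)) = S * (3 * W / (2 * p * z\<^sup>2 * y)) / F\<^sup>2"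
    if "P \<noteq> 0" "F \<noteq> 0" for P S W F :: real
    using nz that by (simp add: divide_simps power2_eq_square)
  have "(2 * s) ^ (2 * m - 1) * (3 * y * (3 * y * (2 * x + 1) - p * \<rho>) / (4 ^ m * (fact (m + 1))\<^sup>2 * z\<^sup>2 * p))
     = s ^ (2 * m - 1) * (3 * (3 * y * (2 * x + 1) - p * \<rho>) / (2 * p * z\<^sup>2 * y)) / (fact m)\<^sup>2"
    unfolding power fact by (rule cancel) simp_all
  then show ?thesis
    unfolding profile_def G [unfolded x_def] by (simp add: x_def y_def z_def p_def)
qed

section \<open>Location and comparison of the critical points\<close>

context
  fixes m :: nat and \<rho> s0 s1 :: real
  assumes m: "m \<ge> 1"
  defines "\<rho> \<equiv> sqrt (3 * (real m + 1) * (2 * real m + 3))"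
  defines "s0 \<equiv> ((real m + 1) * (2 * real m + 3) - \<rho>) / (2 * (2 * real m + 5) * (2 * real m + 3))"
  defines "s1 \<equiv> ((real m + 1) * (2 * real m + 3) + \<rho>) / (2 * (2 * real m + 5) * (2 * real m + 3))"
begin

lemma rho_square: "\<rho>\<^sup>2 = 3 * (real m + 1) * (2 * real m + 3)"
  by (simp add: \<rho>_def)

text \<open>The bounds serve, in this order, to place \<open>s0\<close> below the middle critical
  point, to make \<open>s0\<close> positive and to keep \<open>s1\<close> below 1/4.\<close>

lemma rho_bounds: "3 \<le> \<rho>" "\<rho> < (real m + 1) * (2 * real m + 3)" "2 * \<rho> \<le> 3 * (2 * real m + 3)"
proof -
  have m1: "real m \<ge> 1"
    using m by simp
  have "9 \<le> 3 * ((real m + 1) * (2 * real m + 3))"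
    using m1 mult_mono [of 2 "real m + 1" 5 "2 * real m + 3"] by linarith
  moreover have "(3::real)\<^sup>2 = 9"
    by simp
  ultimately have "3\<^sup>2 \<le> 3 * ((real m + 1) * (2 * real m + 3))"
    by linarith
  then show "3 \<le> \<rho>"
    unfolding \<rho>_def mult.assoc by (rule real_le_rsqrt)
  define b where "b = (real m + 1) * (2 * real m + 3)"
  have "3 < b"
    using m1 mult_mono [of 2 "real m + 1" 5 "2 * real m + 3"] by (simp add: b_def)
  then have "3 * b < b * b"
    by (intro mult_strict_right_mono) auto
  moreover have "\<rho>\<^sup>2 = 3 * b"
    unfolding rho_square b_def by (simp only: mult.assoc)
  ultimately have "\<rho>\<^sup>2 < b\<^sup>2"
    by (simp add: power2_eq_square)
  then have "\<rho> < b"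
    by (rule power_less_imp_less_base) (use \<open>3 < b\<close> in simp)
  then show "\<rho> < (real m + 1) * (2 * real m + 3)"
    by (simp only: b_def)
  have "(2 * \<rho>)\<^sup>2 = (12 * (real m + 1)) * (2 * real m + 3)"
    by (simp add: rho_square power_mult_distrib)
  also have "\<dots> \<le> (9 * (2 * real m + 3)) * (2 * real m + 3)"
    using m1 by (intro mult_right_mono) auto
  also have "9 * k * k = (3 * k)\<^sup>2" for k :: real
    by (simp add: power2_eq_square)
  finally show "2 * \<rho> \<le> 3 * (2 * real m + 3)"
    by (rule power2_le_imp_le) simp
qed

lemma critical_points:
  "0 < s0" "s0 \<le> real m / (2 * (2 * real m + 3))" "real m / (2 * (2 * real m + 3)) \<le> s1" "s1 \<le> 1/4"
proof -
  have d: "2 * (2 * real m + 5) * (2 * real m + 3) > 0"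
    by (intro mult_pos_pos) auto
  show "0 < s0"
    unfolding s0_def using rho_bounds d by (intro divide_pos_pos) auto
  have "real m / (2 * (2 * real m + 3)) = (real m * (2 * real m + 5)) / ((2 * (2 * real m + 3)) * (2 * real m + 5))"
    by (subst mult_divide_mult_cancel_right) auto
  also have "(2 * (2 * real m + 3)) * (2 * real m + 5) = 2 * (2 * real m + 5) * (2 * real m + 3)"
    by (simp only: mult_ac)
  finally show "s0 \<le> real m / (2 * (2 * real m + 3))" "real m / (2 * (2 * real m + 3)) \<le> s1"
    unfolding s0_def s1_def using rho_bounds d
    by (simp_all only:) (intro divide_right_mono; simp add: algebra_simps)+
  have "4 * ((real m + 1) * (2 * real m + 3) + \<rho>) \<le> 2 * (2 * real m + 5) * (2 * real m + 3)"
    using rho_bounds by (simp add: algebra_simps)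
  then show "s1 \<le> 1/4"
    unfolding s1_def using d by (simp add: divide_le_eq)
qed

text \<open>After taking logarithms of the two critical values the claim reads
  \<open>artanh (p * \<rho> / e) \<le> p * artanh (\<rho> / b)\<close>. The upper
  \<open>artanh\<close> bound on the left and the lower one on the right leave the rational
  inequality \<open>key\<close>.\<close>

lemma profile_critical_le: "profile m s0 \<le> profile m s1"
proof -
  define x where "x = real m"
  define b where "b = (x + 1) * (2 * x + 3)"
  define e where "e = 3 * (x + 1) * (2 * x + 1)"
  define p where "p = 2 * x - 1"
  have m1: "x \<ge> 1"
    using m by (simp add: x_def)
  have pos: "b > 0" "e > 0" "p > 0" "\<rho> > 0" "\<rho> < b"
    using m1 rho_bounds by (auto simp: b_def e_def p_def x_def)
  have pm: "p = real (2 * m - 1)"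
    using m by (simp add: p_def x_def of_nat_diff)
  \<comment> \<open>The difference factors as \<open>3 * (x + 1) * (8 * x * x + 14 * x - 3)\<close>,
    which is nonnegative for \<open>x \<ge> 1\<close>.\<close>
  have key: "b * e \<le> e\<^sup>2 - (p * \<rho>)\<^sup>2"
  proof -
    have "x * x \<ge> 1"
      using mult_mono [of 1 x 1 x] m1 by simp
    then have "0 \<le> (3 * (x + 1)) * (8 * x * x + 14 * x - 3)"
      using m1 by (intro mult_nonneg_nonneg) auto
    also have "\<dots> = e\<^sup>2 - p\<^sup>2 * (3 * (x + 1) * (2 * x + 3)) - b * e"
      by (simp add: e_def b_def p_def algebra_simps power2_eq_square)
    finally show ?thesis
      using rho_square by (simp add: power_mult_distrib x_def)
  qed
  have "(p * \<rho>)\<^sup>2 < e\<^sup>2"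
    using key pos mult_pos_pos [of b e] by linarith
  then have pe: "p * \<rho> < e"
    by (rule power_less_imp_less_base) (use pos in simp)
  define u where "u = \<rho> / b"
  define w where "w = p * \<rho> / e"
  have u: "0 < u" "u < 1" and w: "0 < w" "w < 1"
    using pos pe by (auto simp: u_def w_def)
  have "w / (1 - w\<^sup>2) \<le> p * u"
  proof -
    have "1 - w\<^sup>2 > 0"
      using w by (simp add: power_less_one_iff)
    moreover have "b / e \<le> 1 - w\<^sup>2"
      using key pos by (simp add: w_def divide_simps power2_eq_square mult.commute)
    then have "p * u * (b / e) \<le> p * u * (1 - w\<^sup>2)"
      using pos u by (intro mult_left_mono) auto
    then have "w \<le> p * u * (1 - w\<^sup>2)"
      using pos by (simp add: u_def w_def)
    ultimately show ?thesis
      by (simp add: divide_le_eq)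
  qed
  also have "p * u \<le> p * artanh u"
    using artanh_ge_self [of u] u pos by (intro mult_left_mono) auto
  finally have "artanh w \<le> p * artanh u"
    using artanh_le [of w] w by linarith
  moreover have "2 * artanh u = ln (b + \<rho>) - ln (b - \<rho>)"
  proof -
    have "(1 + u) / (1 - u) = (b + \<rho>) / (b - \<rho>)"
      using pos by (simp add: u_def divide_simps)
    then show ?thesis
      using pos by (simp add: artanh_def ln_div)
  qed
  moreover have "2 * artanh w = ln (e + p * \<rho>) - ln (e - p * \<rho>)"
  proof -
    have "(1 + w) / (1 - w) = (e + p * \<rho>) / (e - p * \<rho>)"
      using pos by (simp add: w_def divide_simps)
    moreover have "e + p * \<rho> > 0"
      using pos by (intro add_pos_pos mult_pos_pos)
    ultimately show ?thesis
      using pe by (simp add: artanh_def ln_div)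
  qed
  ultimately have "ln (e + p * \<rho>) - ln (e - p * \<rho>) \<le> p * (ln (b + \<rho>) - ln (b - \<rho>))"
    by (metis mult.left_commute mult_left_mono zero_le_numeral)
  then have "p * ln (b - \<rho>) + ln (e + p * \<rho>) \<le> p * ln (b + \<rho>) + ln (e - p * \<rho>)"
    by (simp add: algebra_simps)
  moreover have ep: "e + p * \<rho> > 0"
    using pos by (intro add_pos_pos mult_pos_pos)
  ultimately have "ln ((b - \<rho>) ^ (2 * m - 1) * (e + p * \<rho>)) \<le> ln ((b + \<rho>) ^ (2 * m - 1) * (e - p * \<rho>))"
    using pos pe by (simp add: ln_mult ln_realpow pm)
  then have main: "(b - \<rho>) ^ (2 * m - 1) * (e + p * \<rho>) \<le> (b + \<rho>) ^ (2 * m - 1) * (e - p * \<rho>)"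
    using pos pe ep by (subst (asm) ln_le_cancel_iff) auto
  define d where "d = (2 * x + 5) * (2 * x + 3)"
  define K where "K = 3 * (x + 1) / (4 ^ m * (fact (m + 1))\<^sup>2 * (2 * x + 5)\<^sup>2 * p)"
  have K: "K / d ^ (2 * m - 1) \<ge> 0"
    using m1 pos by (auto simp: K_def d_def)
  have "s0 = (b - \<rho>) / (2 * d)" "s1 = (b + \<rho>) / (2 * d)"
    by (simp_all only: s0_def s1_def b_def d_def x_def mult.assoc)
  moreover have "2 * (u / (2 * d)) = u / d" for u
    by simp
  ultimately have "2 * s0 = (b - \<rho>) / d" "2 * s1 = (b + \<rho>) / d"
    by (simp_all only:)
  moreover have "profile m s0 = (2 * s0) ^ (2 * m - 1) * (K * (e + p * \<rho>))"
    using profile_critical_value [OF m, of "- \<rho>" s0] rho_square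
    by (simp add: s0_def K_def e_def p_def x_def)
  moreover have "profile m s1 = (2 * s1) ^ (2 * m - 1) * (K * (e - p * \<rho>))"
    using profile_critical_value [OF m, of \<rho> s1] rho_square
    by (simp add: s1_def K_def e_def p_def x_def)
  ultimately show ?thesis
    using mult_left_mono [OF main K] by (simp add: power_divide mult_ac)
qed

text \<open>The sign of \<open>Q\<close> changes at \<open>s0\<close>, \<open>z\<close> and
  \<open>s1\<close>: the profile rises to \<open>s0\<close>, falls to \<open>z\<close>, rises to
  \<open>s1\<close> and falls afterwards. So only \<open>s0\<close> competes with \<open>s1\<close>,
  and that comparison is already settled.\<close>

lemma profile_le_max:
  assumes "0 \<le> s" "s \<le> 1/4"
  shows "profile m s \<le> profile m s1"
proof -
  define z where "z = real m / (2 * (2 * real m + 3))"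
  define Q where "Q t = (t - s0) * (t - s1) * (z - t)" for t
  define C where "C t = t ^ (2 * m - 2) * (8 * (2 * real m + 5) * (2 * real m + 3) * (2 * real m + 3)) / ((real m + 1) * (fact m)\<^sup>2)" for t
  \<comment> \<open>The exponent \<open>2 * m - 2\<close> is even, so the weight is nonnegative for
    every real \<open>t\<close>.\<close>
  have C: "C t \<ge> 0" for t
    unfolding C_def by (intro divide_nonneg_nonneg mult_nonneg_nonneg) (auto simp: zero_le_even_power)
  have z: "2 * (2 * real m + 3) * z = real m"
    by (simp add: z_def)
  have der: "(profile m has_real_derivative C t * Q t) (at t)" for t
  proof -
    define k where "k = 2 * real m + 3"
    define l where "l = 2 * real m + 5"
    have "critical_quadratic m t = 4 * l * k * (t - s0) * (t - s1)"
      using critical_quadratic_factor [of m \<rho> t] m rho_square by (simp only: s0_def s1_def k_def l_def)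
    moreover have "real m - 2 * k * t = 2 * k * (z - t)"
      using z by (simp add: k_def algebra_simps)
    ultimately have "t ^ (2 * m - 2) * (critical_quadratic m t * (m - 2 * k * t)) / ((real m + 1) * (fact m)\<^sup>2) = C t * Q t"
      by (simp add: C_def Q_def k_def [symmetric] l_def [symmetric])
    then show ?thesis
      using profile_has_derivative [OF m, of t] unfolding k_def by (simp only:)
  qed
  have le: "s0 \<le> z" "z \<le> s1" "s1 \<le> 1/4"
    using critical_points by (auto simp: z_def)
  have up: "profile m u \<le> profile m v" if "u \<le> v" "\<And>t. u \<le> t \<Longrightarrow> t \<le> v \<Longrightarrow> Q t \<ge> 0" for u v
  proof (rule DERIV_nonneg_imp_nondecreasing [OF \<open>u \<le> v\<close>])
    fix t assume "u \<le> t" "t \<le> v"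
    then have "C t * Q t \<ge> 0"
      using that(2) C by (intro mult_nonneg_nonneg)
    then show "\<exists>y. (profile m has_real_derivative y) (at t) \<and> 0 \<le> y"
      using der by blast
  qed
  have down: "profile m u \<ge> profile m v" if "u \<le> v" "\<And>t. u \<le> t \<Longrightarrow> t \<le> v \<Longrightarrow> Q t \<le> 0" for u v
  proof (rule DERIV_nonpos_imp_nonincreasing [OF \<open>u \<le> v\<close>])
    fix t assume "u \<le> t" "t \<le> v"
    then have "C t * Q t \<le> 0"
      using that(2) C by (intro mult_nonneg_nonpos)
    then show "\<exists>y. (profile m has_real_derivative y) (at t) \<and> y \<le> 0"
      using der by blast
  qed
  have Q1: "Q t \<ge> 0" if "t \<le> s0" for t
    unfolding Q_def by (rule mult_nonneg_nonneg [OF mult_nonpos_nonpos]) (use that le in simp_all)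
  have Q2: "Q t \<le> 0" if "s0 \<le> t" "t \<le> z" for t
    unfolding Q_def by (rule mult_nonpos_nonneg [OF mult_nonneg_nonpos]) (use that le in simp_all)
  have Q3: "Q t \<ge> 0" if "z \<le> t" "t \<le> s1" for t
    unfolding Q_def by (rule mult_nonpos_nonpos [OF mult_nonneg_nonpos]) (use that le in simp_all)
  have Q4: "Q t \<le> 0" if "s1 \<le> t" for t
    unfolding Q_def by (rule mult_nonneg_nonpos [OF mult_nonneg_nonneg]) (use that le in simp_all)
  consider "s \<le> s0" | "s0 \<le> s" "s \<le> z" | "z \<le> s" "s \<le> s1" | "s1 \<le> s"
    by linarith
  then show ?thesis
  proof cases
    case 1
    then have "profile m s \<le> profile m s0"
      using Q1 by (intro up)
    then show ?thesis
      using profile_critical_le by simp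
  next
    case 2
    then have "profile m s \<le> profile m s0"
      using Q2 by (intro down) auto
    then show ?thesis
      using profile_critical_le by simp
  next
    case 3
    then show ?thesis
      using Q3 by (intro up) auto
  next
    case 4
    then show ?thesis
      using Q4 by (intro down)
  qed
qed

end

section \<open>The explicit formula for k = 3\<close>

lemma poly_endpoint_poly: "poly (endpoint_poly n) a = (a * a - a) ^ n"
  by (simp add: endpoint_poly_def algebra_simps)

lemma poly_pderiv_endpoint_poly:
  "poly (pderiv (endpoint_poly (Suc n))) a = (real n + 1) * (a * a - a) ^ n * (2 * a - 1)"
  unfolding endpoint_poly_def pderiv_power_Suc by (simp add: pderiv_pCons algebra_simps)

text \<open>The first derivative is a multiple of the previous endpoint polynomial times
  \<open>2 * x - 1\<close>. Differentiate that product and use that the square of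
  \<open>2 * a - 1\<close> is \<open>1 + 4 * (a * a - a)\<close>.\<close>

lemma poly_pderiv2_endpoint_poly:
  "poly (pderiv (pderiv (endpoint_poly (Suc (Suc n))))) a
     = (real n + 2) * (a * a - a) ^ n * ((real n + 1) + (4 * real n + 6) * (a * a - a))"
proof -
  have "pderiv (endpoint_poly (Suc (Suc n))) = smult (real n + 2) (endpoint_poly (Suc n) * [:-1, 2:])"
    unfolding endpoint_poly_def pderiv_power_Suc by (simp add: pderiv_pCons algebra_simps)
  then have "poly (pderiv (pderiv (endpoint_poly (Suc (Suc n))))) a
      = (real n + 2) * (poly (endpoint_poly (Suc n)) a * 2 + (2 * a - 1) * poly (pderiv (endpoint_poly (Suc n))) a)"
    by (simp only: pderiv_smult pderiv_mult poly_smult poly_add poly_mult) (simp add: pderiv_pCons algebra_simps)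
  then show ?thesis
    unfolding poly_pderiv_endpoint_poly poly_endpoint_poly by (simp add: algebra_simps)
qed

text \<open>With \<open>r = m - 1\<close> fixed, \<open>q0\<close> to \<open>q3\<close> project to
  degrees below \<open>m\<close>, \<open>m + 1\<close>, \<open>m + 2\<close>, \<open>m + 3\<close>,
  so \<open>k = n - 1 - r\<close> runs from 0 to 3. The three subtracted terms involve the
  derivatives of order 0, 1, 2 of successive endpoint polynomials.\<close>

lemma A_emb_3_eq_profile:
  assumes m: "m \<ge> 1" and a: "0 \<le> a" "a \<le> 1"
  shows "A_emb (m + 3) 3 a \<ge> 0" "(A_emb (m + 3) 3 a)\<^sup>2 = profile m (a * (1 - a))"
proof -
  obtain r where r: "m = Suc r"
    using m by (cases m) auto
  define s where "s = a * (1 - a)"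
  have t: "a * a - a = - s"
    by (simp add: s_def algebra_simps)
  obtain q0 where q0: "kernel_projection m r a q0"
    "kernel_residual r a q0 = s ^ (2 * r + 1) / ((fact r)\<^sup>2 * (2 * real r + 1))"
    using kernel_projection_base [OF a, of r] unfolding r s_def by blast
  obtain q1 where q1: "kernel_projection (m + 1) r a q1" "kernel_residual r a q1 = kernel_residual r a q0 -
      (2 * real m + 1) / (fact m)\<^sup>2 * ((- s) ^ m)\<^sup>2"
    using kernel_projection_Suc [OF q0(1) _ a] by (auto simp: r poly_endpoint_poly t)
  obtain q2 where q2: "kernel_projection (m + 2) r a q2" "kernel_residual r a q2 = kernel_residual r a q1 -
      (2 * real (m + 1) + 1) / (fact (m + 1))\<^sup>2 * ((real m + 1) * (- s) ^ m * (2 * a - 1))\<^sup>2"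
    using kernel_projection_Suc [OF q1(1) _ a] poly_pderiv_endpoint_poly [of m a] by (auto simp: r t)
  obtain q3 where q3: "kernel_projection (m + 3) r a q3" "kernel_residual r a q3 = kernel_residual r a q2 -
      (2 * real (m + 2) + 1) / (fact (m + 2))\<^sup>2 * ((real m + 2) * (- s) ^ m * ((real m + 1) + (4 * real m + 6) * (- s)))\<^sup>2"
    using kernel_projection_Suc [OF q2(1) _ a] poly_pderiv2_endpoint_poly [of m a]
    by (auto simp: r t numeral_2_eq_2 numeral_3_eq_3)
  have A: "A_emb (m + 3) 3 a = sqrt (kernel_residual r a q3)"
    using A_emb_eq_sqrt_kernel_residual [OF q3(1) _ a] by (simp add: r numeral_3_eq_3)
  moreover have "kernel_residual r a q3 \<ge> 0"
    using kernel_residual_nonneg [OF q3(1) a(2)] .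
  ultimately show "A_emb (m + 3) 3 a \<ge> 0"
    by simp
  define x where "x = real m"
  have x: "x \<ge> 1" "2 * x - 1 \<noteq> 0"
    using m by (auto simp: x_def)
  \<comment> \<open>\<open>S / (fact m)\<^sup>2\<close> is common to all four contributions; the
    remaining factors are collected into \<open>profile_factor\<close> by \<open>G\<close>.\<close>
  define S where "S = s ^ (2 * m - 1)"
  have "((- s) ^ m)\<^sup>2 = s ^ (2 * m)"
    by (metis power2_minus power_commutes power_even_eq power_mult)
  also have "\<dots> = S * s"
    unfolding S_def by (simp add: r)
  finally have sm: "((- s) ^ m)\<^sup>2 = S * s" .
  have e0: "s ^ (2 * r + 1) / ((fact r)\<^sup>2 * (2 * real r + 1)) = S / (fact m)\<^sup>2 * (x\<^sup>2 / (2 * x - 1))"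
    by (simp add: S_def r x_def power_mult_distrib)
  have e1: "(2 * real m + 1) / (fact m)\<^sup>2 * ((- s) ^ m)\<^sup>2 = S / (fact m)\<^sup>2 * (s * (2 * x + 1))"
    unfolding sm by (simp add: x_def)
  have a2: "(2 * a - 1)\<^sup>2 = 1 - 4 * s"
    by (simp add: s_def power2_eq_square algebra_simps)
  have e2: "(2 * real (m + 1) + 1) / (fact (m + 1))\<^sup>2 * ((real m + 1) * (- s) ^ m * (2 * a - 1))\<^sup>2
      = S / (fact m)\<^sup>2 * (s * (2 * x + 3) * (1 - 4 * s))"
  proof -
    have "(fact (m + 1))\<^sup>2 = (x + 1)\<^sup>2 * (fact m)\<^sup>2"
      by (simp add: x_def power_mult_distrib add.commute)
    moreover have "((real m + 1) * (- s) ^ m * (2 * a - 1))\<^sup>2 = (x + 1)\<^sup>2 * (S * s) * (1 - 4 * s)"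
      unfolding power_mult_distrib sm a2 by (simp add: x_def)
    moreover have "(x + 1)\<^sup>2 \<noteq> 0"
      using x by simp
    ultimately show ?thesis
      by (simp add: x_def add_ac)
  qed
  have e3: "(2 * real (m + 2) + 1) / (fact (m + 2))\<^sup>2 * ((real m + 2) * (- s) ^ m * ((real m + 1) + (4 * real m + 6) * (- s)))\<^sup>2
      = S / (fact m)\<^sup>2 * (s * (2 * x + 5) * ((x + 1) - (4 * x + 6) * s)\<^sup>2 / (x + 1)\<^sup>2)"
  proof -
    have "fact (Suc (Suc m)) = real (Suc (Suc m)) * (real (Suc m) * fact m)"
      by (simp only: fact_Suc)
    moreover have "m + 2 = Suc (Suc m)" "real (Suc (Suc m)) = x + 2" "real (Suc m) = x + 1"
      by (simp_all add: x_def)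
    ultimately have "fact (m + 2) = (x + 2) * ((x + 1) * fact m)"
      by (simp only:)
    then have "(fact (m + 2))\<^sup>2 = (x + 2)\<^sup>2 * ((x + 1)\<^sup>2 * (fact m)\<^sup>2)"
      by (simp only: power_mult_distrib)
    moreover have "((real m + 2) * (- s) ^ m * ((real m + 1) + (4 * real m + 6) * (- s)))\<^sup>2
        = (x + 2)\<^sup>2 * (S * s) * ((x + 1) - (4 * x + 6) * s)\<^sup>2"
      unfolding power_mult_distrib sm by (simp add: x_def)
    moreover have "(x + 1)\<^sup>2 \<noteq> 0" "(x + 2)\<^sup>2 \<noteq> 0"
      using x by simp_all
    ultimately show ?thesis
      by (simp add: x_def add_ac mult_ac)
  qed
  have G: "profile_factor x s = x\<^sup>2 / (2 * x - 1) - s * (2 * x + 1) - s * (2 * x + 3) * (1 - 4 * s)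
      - s * (2 * x + 5) * ((x + 1) - (4 * x + 6) * s)\<^sup>2 / (x + 1)\<^sup>2"
  proof -
    have y: "x + 1 \<noteq> 0"
      using x by simp
    have "s * (2 * x + 5) * ((x + 1) - (4 * x + 6) * s)\<^sup>2 / (x + 1)\<^sup>2
        = s * (2 * x + 5) - 4 * (2 * x + 5) * (2 * x + 3) / (x + 1) * s\<^sup>2 + 4 * (2 * x + 5) * (2 * x + 3)\<^sup>2 / (x + 1)\<^sup>2 * s ^ 3"
      using y by (simp add: divide_simps) (simp add: algebra_simps power2_eq_square power3_eq_cube)
    moreover have "12 * (2 * x + 3) * (x + 2) / (x + 1) * s\<^sup>2 = 4 * (2 * x + 3) * s\<^sup>2 + 4 * (2 * x + 5) * (2 * x + 3) / (x + 1) * s\<^sup>2"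
      using y by (simp add: divide_simps) (simp add: algebra_simps)
    ultimately show ?thesis
      unfolding profile_factor_def by (simp add: algebra_simps power2_eq_square)
  qed
  have "kernel_residual r a q3 = S / (fact m)\<^sup>2 * profile_factor x s"
    unfolding q3(2) q2(2) q1(2) q0(2) e0 e1 e2 e3 G by (simp add: algebra_simps)
  then show "(A_emb (m + 3) 3 a)\<^sup>2 = profile m (a * (1 - a))"
    using \<open>kernel_residual r a q3 \<ge> 0\<close>
    by (simp add: A profile_def S_def x_def s_def)
qed

theorem mainTheorem5:
  fixes n :: nat and t\<^sub>1 a\<^sub>p a\<^sub>m :: real
  assumes n: "n \<ge> 4"
    and t1: "t\<^sub>1 = (- (real n - 2) * (2 * real n - 3) - sqrt (3 * (real n - 2) * (2 * real n - 3)))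
                   / (2 * (2 * real n - 1) * (2 * real n - 3))"
    and ap: "a\<^sub>p = 1/2 + 1/2 * sqrt (1 + 4 * t\<^sub>1)"
    and am: "a\<^sub>m = 1/2 - 1/2 * sqrt (1 + 4 * t\<^sub>1)"
  shows "(\<forall>a\<in>{a\<^sub>p, a\<^sub>m}. a \<in> {0..1} \<and>
            (\<forall>b\<in>{0..1}. (A_emb n 3 b)\<^sup>2 \<le> (A_emb n 3 a)\<^sup>2) \<and>
            (A_emb n 3 a)\<^sup>2 = (Lambda_emb n 3)\<^sup>2) \<and>
         (Lambda_emb n 3)\<^sup>2 =
           (((real n - 2) * (2 * real n - 3) + sqrt (3 * (real n - 2) * (2 * real n - 3)))
             / ((2 * real n - 1) * (2 * real n - 3))) ^ (2 * n - 7) *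
           (3 * (real n - 2) *
              (3 * (real n - 2) * (2 * real n - 5)
                - sqrt 3 * (2 * real n - 7) * sqrt ((real n - 2) * (2 * real n - 3)))
             / (4 ^ (n - 3) * (fact (n - 2))\<^sup>2 * (2 * real n - 1)\<^sup>2 * (2 * real n - 7)))"
proof -
  define m where "m = n - 3"
  have nm: "n = m + 3" and m: "m \<ge> 1"
    using n by (simp_all add: m_def)
  define \<rho> where "\<rho> = sqrt (3 * (real m + 1) * (2 * real m + 3))"
  define s1 where "s1 = ((real m + 1) * (2 * real m + 3) + \<rho>) / (2 * (2 * real m + 5) * (2 * real m + 3))"
  \<comment> \<open>Restates every parameter of the formula in terms of \<open>m\<close>, including
    the truncated natural-number exponents.\<close>
  have subst: "real n - 2 = real m + 1" "2 * real n - 3 = 2 * real m + 3" "2 * real n - 1 = 2 * real m + 5"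
    "2 * real n - 5 = 2 * real m + 1" "2 * real n - 7 = 2 * real m - 1" "n - 3 = m" "n - 2 = m + 1" "2 * n - 7 = 2 * m - 1"
    by (simp_all add: nm)
  have s1_le: "s1 \<le> 1/4" "0 \<le> s1"
    using critical_points [OF m] by (auto simp: s1_def \<rho>_def)
  have "- u * k - v = - (u * k + v)" for u k v :: real
    by simp
  then have "t\<^sub>1 = - s1"
    unfolding t1 subst s1_def \<rho>_def minus_divide_left by (simp only:)
  \<comment> \<open>\<open>t\<^sub>1\<close> stands for \<open>a * a - a\<close>, hence for
    \<open>- s1\<close>. The points \<open>a\<^sub>p\<close> and \<open>a\<^sub>m\<close> are
    \<open>(1 + w) / 2\<close> and \<open>(1 - w) / 2\<close>, both with
    \<open>a * (1 - a) = (1 - w * w) / 4\<close>.\<close>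
  define w where "w = sqrt (1 + 4 * t\<^sub>1)"
  have "w\<^sup>2 = 1 - 4 * s1" and w: "0 \<le> w" "w \<le> 1"
    using \<open>t\<^sub>1 = - s1\<close> s1_le by (auto simp: w_def)
  then have "s1 = (1 - w * w) / 4"
    by (simp add: power2_eq_square)
  then have attain: "a \<in> {0..1} \<and> a * (1 - a) = s1" if "a \<in> {a\<^sub>p, a\<^sub>m}" for a
  proof -
    have "w = 2 * a - 1 \<or> w = 1 - 2 * a"
      using that unfolding ap am w_def [symmetric] by auto
    then have "a \<in> {0..1} \<and> 1 - w * w = 4 * (a * (1 - a))"
    proof
      assume "w = 2 * a - 1"
      then show ?thesis
        using w unfolding \<open>w = 2 * a - 1\<close> by (simp add: algebra_simps)
    next
      assume "w = 1 - 2 * a"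
      then show ?thesis
        using w unfolding \<open>w = 1 - 2 * a\<close> by (simp add: algebra_simps)
    qed
    then show ?thesis
      using \<open>s1 = (1 - w * w) / 4\<close> by simp
  qed
  have max: "(A_emb n 3 b)\<^sup>2 \<le> profile m s1" if "b \<in> {0..1}" for b
  proof -
    have "b * (1 - b) \<le> 1/4"
      using zero_le_square [of "b - 1/2"] by (simp add: algebra_simps)
    then have "profile m (b * (1 - b)) \<le> profile m s1"
      unfolding s1_def \<rho>_def using that by (intro profile_le_max [OF m]) auto
    then show ?thesis
      using A_emb_3_eq_profile(2) [OF m, of b] that by (simp only: nm atLeastAtMost_iff)
  qed
  have val: "(A_emb n 3 a)\<^sup>2 = profile m s1" if "a \<in> {a\<^sub>p, a\<^sub>m}" for a
    using A_emb_3_eq_profile(2) [OF m, of a] attain [OF that] by (simp only: nm atLeastAtMost_iff)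
  \<comment> \<open>The maximum is known for the squares; nonnegativity of \<open>A_emb\<close>
    carries it over to the values whose supremum is taken.\<close>
  have "Lambda_emb n 3 = A_emb n 3 a\<^sub>p"
    unfolding Lambda_emb_def
  proof (rule cSup_eq_maximum)
    show "A_emb n 3 a\<^sub>p \<in> A_emb n 3 ` {0..1}"
      using attain [of a\<^sub>p] by (intro imageI) simp
    fix y assume "y \<in> A_emb n 3 ` {0..1}"
    then obtain b where b: "b \<in> {0..1}" "y = A_emb n 3 b"
      by auto
    have "(A_emb n 3 b)\<^sup>2 \<le> (A_emb n 3 a\<^sub>p)\<^sup>2"
      using max [OF b(1)] val [of a\<^sub>p] by simp
    moreover have "0 \<le> A_emb n 3 a\<^sub>p"
      using A_emb_3_eq_profile(1) [OF m, of a\<^sub>p] attain [of a\<^sub>p] unfolding nm by simp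
    ultimately show "y \<le> A_emb n 3 a\<^sub>p"
      unfolding b(2) by (rule power2_le_imp_le)
  qed
  then have L: "(Lambda_emb n 3)\<^sup>2 = profile m s1"
    using val [of a\<^sub>p] by simp
  \<comment> \<open>The target formula has the root split into \<open>sqrt 3\<close> and a second
    root, unlike \<open>\<rho>\<close>.\<close>
  have "\<rho> = sqrt 3 * sqrt ((real m + 1) * (2 * real m + 3))"
    unfolding \<rho>_def by (simp only: mult.assoc real_sqrt_mult)
  then have \<rho>': "sqrt 3 * (2 * real m - 1) * sqrt ((real m + 1) * (2 * real m + 3)) = (2 * real m - 1) * \<rho>"
    by (simp only: mult_ac)
  have "2 * (u / (2 * k * l)) = u / (k * l)" for u k l :: real
    by simp
  then have two: "2 * s1 = ((real m + 1) * (2 * real m + 3) + \<rho>) / ((2 * real m + 5) * (2 * real m + 3))"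
    unfolding s1_def by (simp only:)
  have "\<rho>\<^sup>2 = 3 * (real m + 1) * (2 * real m + 3)"
    by (simp add: \<rho>_def)
  note crit_value = profile_critical_value [OF m this s1_def]
  show ?thesis
  proof
    show "\<forall>a\<in>{a\<^sub>p, a\<^sub>m}. a \<in> {0..1} \<and> (\<forall>b\<in>{0..1}. (A_emb n 3 b)\<^sup>2 \<le> (A_emb n 3 a)\<^sup>2) \<and>
        (A_emb n 3 a)\<^sup>2 = (Lambda_emb n 3)\<^sup>2"
    proof (intro ballI conjI)
      fix a assume a: "a \<in> {a\<^sub>p, a\<^sub>m}"
      show "a \<in> {0..1}" "(A_emb n 3 a)\<^sup>2 = (Lambda_emb n 3)\<^sup>2"
        using attain [OF a] val [OF a] L by simp_all
      fix b :: real assume "b \<in> {0..1}"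
      then show "(A_emb n 3 b)\<^sup>2 \<le> (A_emb n 3 a)\<^sup>2"
        using max val [OF a] by (simp only:)
    qed
  qed (unfold L subst \<rho>' \<rho>_def [symmetric] crit_value two, rule refl)
qed

end
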